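(* Let $b>1$ be an integer and let $s$ be a complex number with real part $\sigma=\Re s>1$. Define $$u_0(s)=\frac{b^s}{b^s-b},$$ and, for $m\ge 1$, $$u_m(s)=\frac{1}{m+1}\,\frac{b^{s}}{b^s-b}-\frac{b^{s+1}}{2(b^{s+1}-b)}+\sum_{1\le k\le \lfloor m/2\rfloor}\frac{m!}{(m-2k+1)!}\,\frac{B_{2k}}{(2k)!}\,\frac{b^{s+2k}}{b^{s+2k}-b},$$ and, for $m\ge 0$, $u_m^*(s)=\frac{(s+1)_m}{m!}u_m(s)$. (The same formulas with $s$ replaced by $\sigma$ define $u_m(\sigma)$ and $u_m^*(\sigma)$.) Then the following hold. (1) $|(b^s-b)\,u_m(s)|\le (b^\sigma-b)\,u_m(\sigma)$ for all $m\ge 0$. (2) For all $m\ge 1$, $$u_m^*(s)=\frac{1}{b^{m+s}-b}\sum_{j=1}^{m}\frac{(s+m)(s+m-1)\cdots(s+m-j+1)}{j!}\,u_{m-j}^*(s)\Bigl(\sum_{0\le a<b}a^j\Bigr).$$ (3) If $s=\sigma>1$ is real, then for all $m\ge 0$, $$\frac{1}{b^\sigma-b}<u_m^*(\sigma)\le\frac{b^\sigma}{b^\sigma-b}.$$ (4) For general complex $s$ with $\Re s=\sigma>1$ and all $m\ge 0$, $$|u_m^*(s)|\le\frac{|(s+1)_m|}{(\sigma+1)_m}\,\frac{b^\sigma}{|b^s-b|}\le\frac{\Gamma(\sigma+1)}{|\Gamma(s+1)|}\,\frac{b^\sigma}{|b^s-b|}.$$ (5) For any integer $\ell\ge 2$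 the following series (over $m$) is absolutely convergent and represents the Riemann zeta function: $$\zeta(s)=\sum_{0<n<b^{\ell-1}}\frac{1}{n^s}+\sum_{m=0}^\infty(-1)^m\,\frac{s\,u_m^*(s)}{s+m}\sum_{b^{\ell-1}\le n<b^{\ell}}\frac{1}{n^{m+s}}.$$ (6) In (5), if $s$ is real, the partial sums (the finite sum over $0<n<b^{\ell-1}$ plus finitely many initial terms of the series over $m$) provide alternatingly lower and upper bounds for $\zeta(s)$, i.e. the kind of bound depends only on the parity of the number of terms of the series over $m$ that are kept. (7) For given complex $s$ with $\Re s>1$ and given $\ell\geq 2$, the general term of the series over $m$ in (5) is $O(r^m/m)$ as $m\to\infty$, with $r=b^{1-\ell}$.
   Context: Here $b^s=\exp(s\log b)$ and $n^{s}=\exp(s\log n)$ with real logarithms. For a complex number $z$ and an integer $m\ge 0$, $(z)_m=z(z+1)\cdots(z+m-1)$ is the ascending factorial (Pochhammer symbol), with $(z)_0=1$. The $B_{2k}$ are the Bernoulli numbers, $\frac{t}{e^t-1}=1-\frac t2+\sum_{k\ge1}\frac{B_{2k}}{(2k)!}t^{2k}$. $\Gamma$ is the Euler Gamma function and $\zeta$ the Riemann zeta function. In the sums over $n$, $n$ ranges over integers. *)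

theory Defs
  imports
    "HOL-Analysis.Analysis"
    "HOL-Computational_Algebra.Formal_Power_Series"
    "HOL-Library.Landau_Symbols"
begin

text \<open>
  The definitions below that are polymorphic in \<open>'a::{real_normed_field, ln}\<close> are meant for
  complex and for real arguments. For positive integers \<open>n\<close>, \<open>of_nat n powr s\<close> is
  \<open>exp (s * ln n)\<close> with the real logarithm at both types.
\<close>

text \<open>
  The quotient is taken in the ring of formal power series; the common factor \<open>t\<close> of the
  numerator \<open>t\<close> and the denominator \<open>e\<^sup>t - 1\<close> cancels.
\<close>

definition bernoulli :: "nat \<Rightarrow> real" where
  "bernoulli n = fact n * fps_nth (fps_X / (fps_exp 1 - 1)) n"

text \<open>The Dirichlet series; it gives the Riemann zeta function only in the half plane \<open>Re s > 1\<close>.\<close>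

definition zeta :: "'a \<Rightarrow> 'a::{real_normed_field, ln}" where
  "zeta s = (\<Sum>n. 1 / of_nat (Suc n) powr s)"

definition u_coeff :: "nat \<Rightarrow> nat \<Rightarrow> 'a \<Rightarrow> 'a::{real_normed_field, ln}" where
  "u_coeff b m s =
    (if m = 0 then of_nat b powr s / (of_nat b powr s - of_nat b)
     else
       1 / of_nat (m + 1) * (of_nat b powr s / (of_nat b powr s - of_nat b))
       - of_nat b powr (s + 1) / (2 * (of_nat b powr (s + 1) - of_nat b))
       + (\<Sum>k = 1..m div 2.
            fact m / fact (m - 2 * k + 1) * (of_real (bernoulli (2 * k)) / fact (2 * k))
            * (of_nat b powr (s + of_nat (2 * k))
               / (of_nat b powr (s + of_nat (2 * k)) - of_nat b))))"

definition u_star :: "nat \<Rightarrow> nat \<Rightarrow> 'a \<Rightarrow> 'a::{real_normed_field, ln}" where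
  "u_star b m s = pochhammer (s + 1) m / fact m * u_coeff b m s"

definition zeta_head :: "nat \<Rightarrow> nat \<Rightarrow> 'a \<Rightarrow> 'a::{real_normed_field, ln}" where
  "zeta_head b l s = (\<Sum>n \<in> {0<..<b ^ (l - 1)}. 1 / of_nat n powr s)"

definition zeta_term :: "nat \<Rightarrow> nat \<Rightarrow> 'a \<Rightarrow> nat \<Rightarrow> 'a::{real_normed_field, ln}" where
  "zeta_term b l s m =
    (- 1) ^ m * (s * u_star b m s / (s + of_nat m))
    * (\<Sum>n \<in> {b ^ (l - 1)..<b ^ l}. 1 / of_nat n powr (of_nat m + s))"

end

theory Submission
  imports Defs
begin

text \<open>
  Write \<open>B = b\<^sup>s\<close>, so that \<open>|B| = b\<^sup>\<sigma> > b\<close>. Everything follows from reading \<open>u\<^sub>m(s)\<close> as the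
  \<open>m\<close>-th moment of a measure: give each string of \<open>l\<close> digits in base \<open>b\<close> the mass \<open>B\<^sup>-\<^sup>l\<close> and put
  this mass at the point \<open>n / b\<^sup>l \<in> [0,1)\<close> whose expansion the string is. The moment is
  \<open>\<Sum>l. B\<^sup>-\<^sup>l (\<Sum>n<b\<^sup>l. (n/b\<^sup>l)\<^sup>m)\<close>; the inner sum is a polynomial in \<open>b\<^sup>l\<close> and \<open>b\<^sup>-\<^sup>l\<close> with Bernoulli
  coefficients (\<open>block_moment_bernoulli\<close>), and summing geometric series gives the formula that defines
  \<open>u\<^sub>m(s)\<close> (\<open>digit_moment_bernoulli\<close>).

  Splitting off the last digit of a string shows that \<open>(B - b) u\<^sub>m\<close> is a series in powers of \<open>B\<close> with
  nonnegative coefficients, whence its domination by the value at \<open>|B|\<close>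
  (\<open>norm_digit_moment_le\<close>). Splitting off the first digit expresses the measure by its images under
  \<open>x \<mapsto> (a + x)/b\<close>, and the binomial theorem turns this into the recurrence
  (\<open>digit_moment_recurrence\<close>).

  For real \<open>s = \<sigma>\<close>, reflect \<open>x\<close> to \<open>1 - x\<close>. The reflected measure has as distribution function
  \<open>F(x) = \<Sum>l. b\<^sup>-\<^sup>l\<^sup>\<sigma> \<lfloor>b\<^sup>l x\<rfloor>\<close>, and \<open>u\<^sub>m\<close> is the integral of \<open>F\<close> against \<open>m (1 - x)\<^sup>m\<^sup>-\<^sup>1\<close> on \<open>[0,1]\<close>.
  Comparing \<open>x\<close> with the powers of \<open>b\<close> gives
  \<open>x\<^sup>\<sigma>/(b\<^sup>\<sigma> - b) \<le> F(x) \<le> b\<^sup>\<sigma> x\<^sup>\<sigma>/(b\<^sup>\<sigma> - b)\<close>, and the Beta integral of \<open>x\<^sup>\<sigma>\<close> is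
  \<open>m!/(\<sigma>+1)\<^sub>m\<close>; this is exactly the factor by which \<open>u\<^sub>m\<close> and \<open>u\<^sub>m\<^sup>*\<close> differ (\<open>digit_moment_bounds\<close>). The bounds
  for complex \<open>s\<close> follow by domination, since \<open>|(s+1)\<^sub>m|/(\<sigma>+1)\<^sub>m\<close> increases with \<open>m\<close> to
  \<open>\<Gamma>(\<sigma>+1)/|\<Gamma>(s+1)|\<close>.

  For the series, every \<open>n \<ge> b\<^sup>l\<^sup>-\<^sup>1\<close> is \<open>N b\<^sup>k + r\<close> for exactly one choice of its leading \<open>l\<close> digits
  \<open>N \<in> [b\<^sup>l\<^sup>-\<^sup>1, b\<^sup>l)\<close>, of \<open>k\<close> and of \<open>r < b\<^sup>k\<close>, and \<open>n\<^sup>-\<^sup>s = N\<^sup>-\<^sup>s B\<^sup>-\<^sup>k (1 + x/N)\<^sup>-\<^sup>s\<close> with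
  \<open>x = r/b\<^sup>k\<close>. So the tail of the zeta series is the integral of \<open>\<Sum>N. N\<^sup>-\<^sup>s (1 + x/N)\<^sup>-\<^sup>s\<close> against the digit
  measure, and the binomial series, integrated term by term, produces the moments
  (\<open>zeta_expansion\<close>). If \<open>s\<close> is real, the partial sums of the binomial series lie alternately below and
  above \<open>(1 + y)\<^sup>-\<^sup>\<sigma>\<close> for every \<open>y \<ge> 0\<close> (\<open>binomial_partial_sum_sign\<close>), and integration against a
  positive measure preserves this.
\<close>

section \<open>Bernoulli numbers and power sums\<close>

unbundle fps_syntax


lemma bernoulli_fps_mult:
  "fps_X / (fps_exp 1 - 1) * (fps_exp 1 - 1) = (fps_X :: real fps)"
proof -
  have "subdegree (fps_exp 1 - 1 :: real fps) = 1"
    by (rule subdegreeI) auto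
  moreover have "(fps_exp 1 - 1 :: real fps) \<noteq> 0"
    by (metis calculation subdegree_0 zero_neq_one)
  ultimately have "(fps_exp 1 - 1 :: real fps) dvd fps_X"
    by (subst fps_dvd_iff) auto
  then show ?thesis by simp
qed

lemma fps_nth_bernoulli: "fps_nth (fps_X / (fps_exp 1 - 1)) n = bernoulli n / fact n"
  by (simp add: bernoulli_def)

text \<open>
  Replacing \<open>t\<close> by \<open>-t\<close> in \<open>t/(e\<^sup>t - 1)\<close> gives \<open>t e\<^sup>t/(e\<^sup>t - 1) = t/(e\<^sup>t - 1) + t\<close>. Both the value
  of \<open>B\<^sub>1\<close> and the vanishing of the later odd Bernoulli numbers are read off from this.
\<close>

lemma bernoulli_reflection:
  "(-1) ^ n * bernoulli n = bernoulli n + (if n = 1 then 1 else 0)"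
proof -
  define G :: "real fps" where "G = fps_X / (fps_exp 1 - 1)"
  define E :: "real fps" where "E = fps_exp 1"
  have G: "G * (E - 1) = fps_X"
    using bernoulli_fps_mult by (simp add: G_def E_def)
  have "(G * (E - 1)) oo (- fps_X) = fps_X oo (- fps_X)"
    by (simp only: G)
  then have "(G oo (- fps_X)) * (fps_exp (- 1) - 1) = - fps_X"
    by (simp add: fps_compose_mult_distrib fps_compose_sub_distrib E_def)
  then have "(G oo (- fps_X)) * (E * (fps_exp (- 1) - 1)) = - fps_X * E"
    by (metis mult.commute mult.left_commute)
  moreover have "E * (fps_exp (- 1) - 1) = 1 - E"
    unfolding E_def by (simp add: right_diff_distrib flip: fps_exp_add_mult)
  ultimately have "(G oo (- fps_X)) * (1 - E) = - (G * (E - 1)) * E"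
    by (simp only: G)
  then have "((G oo (- fps_X)) - G * E) * (1 - E) = 0"
    by (simp add: algebra_simps)
  moreover have "1 - E \<noteq> 0"
    using G by fastforce
  ultimately have "G oo (- fps_X) = G * E" by simp
  also have "\<dots> = G + fps_X" using G by (simp add: algebra_simps)
  finally have "(G oo (- fps_X)) $ n = G $ n + (fps_X $ n)" by simp
  moreover have "(G oo (- fps_X)) $ n = (- 1) ^ n * G $ n"
    by (simp add: fps_compose_uminus')
  ultimately show ?thesis
    by (auto simp: G_def fps_nth_bernoulli field_simps split: if_splits)
qed

lemma bernoulli_0: "bernoulli 0 = 1"
proof -
  have "fps_nth (fps_X / (fps_exp 1 - 1) * (fps_exp 1 - 1)) 1 = fps_nth (fps_X :: real fps) 1"
    by (simp only: bernoulli_fps_mult)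
  then show ?thesis
    by (simp add: fps_mult_nth fps_nth_bernoulli)
qed

lemma bernoulli_1: "bernoulli 1 = - 1 / 2"
  using bernoulli_reflection[of 1] by simp

lemma bernoulli_odd: "odd n \<Longrightarrow> n \<noteq> 1 \<Longrightarrow> bernoulli n = 0"
  using bernoulli_reflection[of n] by simp

text \<open>
  The exponential generating function in \<open>m\<close> of the left-hand side is the geometric sum
  \<open>\<Sum>n<N. e\<^sup>n\<^sup>t = t/(e\<^sup>t - 1) \<cdot> (e\<^sup>N\<^sup>t - 1)/t\<close>, and the right-hand side is the Cauchy product of the two factors.
\<close>

lemma sum_powers_bernoulli:
  "(\<Sum>n<N. real n ^ m) =
     (\<Sum>j\<le>m. fact m / fact (m + 1 - j) * (bernoulli j / fact j) * real N ^ (m + 1 - j))"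
proof -
  define G :: "real fps" where "G = fps_X / (fps_exp 1 - 1)"
  define E :: "real fps" where "E = fps_exp 1"
  define H :: "real fps" where "H = Abs_fps (\<lambda>n. real N ^ (n + 1) / fact (n + 1))"
  have G: "G * (E - 1) = fps_X"
    using bernoulli_fps_mult by (simp add: G_def E_def)
  have pow: "E ^ n = fps_exp (real n)" for n
    by (simp add: E_def fps_exp_power_mult)
  \<comment> \<open>\<open>H\<close> is the series of \<open>(e\<^sup>N\<^sup>t - 1)/t\<close>.\<close>
  have "E ^ N - 1 = fps_X * H"
    by (rule fps_ext) (auto simp: pow H_def gr0_conv_Suc)
  have "(E - 1) * (\<Sum>n<N. E ^ n) = E ^ N - 1"
    by (simp add: power_diff_1_eq)
  also have "\<dots> = (E - 1) * (G * H)"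
    by (simp add: \<open>E ^ N - 1 = fps_X * H\<close> mult.assoc mult.left_commute flip: G)
  finally have "(\<Sum>n<N. E ^ n) = G * H"
    using G by fastforce
  then have "(\<Sum>n<N. E ^ n) $ m = (G * H) $ m" by simp
  then have "(\<Sum>n<N. real n ^ m / fact m) =
      (\<Sum>j\<le>m. bernoulli j / fact j * (real N ^ (m - j + 1) / fact (m - j + 1)))"
    by (simp add: pow fps_sum_nth fps_mult_nth G_def fps_nth_bernoulli H_def atLeast0AtMost)
  also have "(\<Sum>n<N. real n ^ m / fact m) = (\<Sum>n<N. real n ^ m) / fact m"
    by (simp add: sum_divide_distrib)
  finally have "(\<Sum>n<N. real n ^ m) =
      (\<Sum>j\<le>m. fact m * (bernoulli j / fact j * (real N ^ (m - j + 1) / fact (m - j + 1))))"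
    by (simp add: field_simps sum_distrib_left)
  also have "\<dots> = (\<Sum>j\<le>m. fact m / fact (m + 1 - j) * (bernoulli j / fact j) * real N ^ (m + 1 - j))"
    by (intro sum.cong refl) (simp add: Suc_diff_le mult_ac)
  finally show ?thesis .
qed

lemma sum_even_indices:
  fixes f :: "nat \<Rightarrow> 'a::comm_monoid_add"
  assumes "\<And>j. odd j \<Longrightarrow> j \<noteq> 1 \<Longrightarrow> f j = 0" and "m \<ge> 1"
  shows "(\<Sum>j\<le>m. f j) = f 0 + f 1 + (\<Sum>k = 1..m div 2. f (2 * k))"
proof -
  have "(\<Sum>j\<le>m. f j) = (\<Sum>j \<in> {0,1} \<union> (\<lambda>k. 2 * k) ` {1..m div 2}. f j)"
  proof (rule sum.mono_neutral_right)
    show "\<forall>i\<in>{..m} - ({0, 1} \<union> (*) 2 ` {1..m div 2}). f i = 0"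
    proof
      fix i assume i: "i \<in> {..m} - ({0, 1} \<union> (*) 2 ` {1..m div 2})"
      have "odd i"
      proof
        assume "even i"
        then obtain k where "i = 2 * k" by blast
        then have "k \<in> {1..m div 2}" using i by auto
        then show False using i \<open>i = 2 * k\<close> by blast
      qed
      then show "f i = 0" using assms i by auto
    qed
  qed (use \<open>m \<ge> 1\<close> in auto)
  also have "\<dots> = (\<Sum>j \<in> {0,1}. f j) + (\<Sum>j \<in> (\<lambda>k. 2 * k) ` {1..m div 2}. f j)"
    by (rule sum.union_disjoint) auto
  also have "(\<Sum>j \<in> (\<lambda>k. 2 * k) ` {1..m div 2}. f j) = (\<Sum>k = 1..m div 2. f (2 * k))"
    by (subst sum.reindex) (auto simp: inj_on_def)
  finally show ?thesis by simp
qed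

section \<open>Power sums over the digit blocks\<close>

text \<open>
  The points of \<open>[0,1)\<close> with an expansion of \<open>l\<close> digits in base \<open>b\<close>, each with mass \<open>1\<close>. For \<open>m = 0\<close> the
  summand at \<open>n = 0\<close> is \<open>0\<^sup>0 = 1\<close>, so the mass \<open>b\<^sup>l\<close> comes out right.
\<close>

definition block_moment :: "nat \<Rightarrow> nat \<Rightarrow> nat \<Rightarrow> real" where
  "block_moment b m l = (\<Sum>n<b ^ l. (real n / real (b ^ l)) ^ m)"

lemma block_moment_bernoulli:
  assumes "b \<ge> 1" and "m \<ge> 1"
  shows "block_moment b m l = 1 / real (m + 1) * real b ^ l - 1 / 2
     + (\<Sum>k = 1..m div 2. fact m / fact (m - 2 * k + 1) * (bernoulli (2 * k) / fact (2 * k))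
          * (real b / real b ^ (2 * k)) ^ l)"
proof -
  define N where "N = b ^ l"
  have N: "N > 0" using assms by (simp add: N_def)
  define f where "f j = fact m / fact (m + 1 - j) * (bernoulli j / fact j)
      * real N ^ (m + 1 - j) / real N ^ m" for j
  have "block_moment b m l = (\<Sum>n<N. real n ^ m) / real N ^ m"
    by (simp add: block_moment_def N_def power_divide sum_divide_distrib)
  also have "\<dots> = (\<Sum>j\<le>m. f j)"
    by (simp add: sum_powers_bernoulli f_def sum_divide_distrib)
  also have "\<dots> = f 0 + f 1 + (\<Sum>k = 1..m div 2. f (2 * k))"
    by (rule sum_even_indices) (use assms in \<open>auto simp: f_def bernoulli_odd\<close>)
  also have "f 0 = 1 / real (m + 1) * real b ^ l"
    using N by (simp add: f_def bernoulli_0 N_def)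
  also have "f 1 = - 1 / 2"
    using N by (simp add: f_def bernoulli_1[simplified])
  also have "(\<Sum>k = 1..m div 2. f (2 * k)) = (\<Sum>k = 1..m div 2.
       fact m / fact (m - 2 * k + 1) * (bernoulli (2 * k) / fact (2 * k))
          * (real b / real b ^ (2 * k)) ^ l)"
  proof (rule sum.cong)
    fix k assume "k \<in> {1..m div 2}"
    then have k: "2 * k \<le> m" by auto
    then have "real N ^ (m + 1 - 2 * k) / real N ^ m = real N / real N ^ (2 * k)"
      using N by (simp add: field_simps flip: power_add power_Suc)
    also have "\<dots> = (real b / real b ^ (2 * k)) ^ l"
      by (simp add: N_def power_divide flip: power_mult) (simp add: mult.commute)
    finally show "f (2 * k) = fact m / fact (m - 2 * k + 1) * (bernoulli (2 * k) / fact (2 * k))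
          * (real b / real b ^ (2 * k)) ^ l"
      using k by (simp add: f_def Suc_diff_le flip: times_divide_eq_right)
  qed auto
  finally show ?thesis by simp
qed

lemma sum_base_block:
  fixes f :: "nat \<Rightarrow> 'a::comm_monoid_add"
  assumes "A \<le> C"
  shows "sum f {A * k..<C * k} = (\<Sum>i \<in> {A..<C}. \<Sum>r<k. f (i * k + r))"
  using assms
proof (induction C rule: dec_induct)
  case (step n)
  have "A * k \<le> n * k" using step by simp
  then have "sum f {A * k..<Suc n * k} = sum f {A * k..<n * k} + sum f {0 + n * k..<k + n * k}"
    using sum.atLeastLessThan_concat [of "A * k" "n * k" "Suc n * k" f] by simp
  also have "sum f {0 + n * k..<k + n * k} = (\<Sum>r<k. f (n * k + r))"
    by (simp only: sum.shift_bounds_nat_ivl atLeast0LessThan add.commute)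
  finally show ?case
    using step by simp
qed auto

lemma sum_base_block_lessThan:
  fixes f :: "nat \<Rightarrow> 'a::comm_monoid_add"
  shows "(\<Sum>n<N * k. f n) = (\<Sum>i<N. \<Sum>r<k. f (i * k + r))"
  using sum_base_block [of 0 N f k] by (simp add: atLeast0LessThan)

lemma block_moment_0 [simp]: "block_moment b 0 l = real b ^ l"
  by (simp add: block_moment_def)

lemma block_moment_nonneg: "block_moment b m l \<ge> 0"
  by (simp add: block_moment_def sum_nonneg)

lemma block_moment_le: "block_moment b m l \<le> real b ^ l"
proof -
  have "(real n / real (b ^ l)) ^ m \<le> 1" if "n < b ^ l" for n
    using that by (intro power_le_one) (auto simp: divide_simps simp del: of_nat_power)
  then have "block_moment b m l \<le> (\<Sum>n<b ^ l. 1)"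
    unfolding block_moment_def by (intro sum_mono) auto
  then show ?thesis by simp
qed

lemma block_moment_level_0: "block_moment b m 0 = (if m = 0 then 1 else 0)"
  by (simp add: block_moment_def)

text \<open>
  A string \<open>n\<close> of \<open>l\<close> digits continued by a digit \<open>a\<close> lies at \<open>(nb + a)/b\<^sup>l\<^sup>+\<^sup>1\<close>, to the right of
  \<open>n/b\<^sup>l\<close>, and there are \<open>b\<close> continuations.
\<close>

lemma block_moment_last_digit:
  assumes "b > 0"
  shows "real b * block_moment b m l \<le> block_moment b m (Suc l)"
proof -
  have "real b * block_moment b m l = (\<Sum>n<b ^ l. \<Sum>a<b. (real n / real (b ^ l)) ^ m)"
    by (simp add: block_moment_def sum_distrib_left)
  also have "\<dots> \<le> (\<Sum>n<b ^ l. \<Sum>a<b. (real (n * b + a) / real (b ^ Suc l)) ^ m)"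
    using assms by (intro sum_mono power_mono) (auto simp: field_simps)
  also have "\<dots> = block_moment b m (Suc l)"
    unfolding block_moment_def by (subst sum_base_block_lessThan [symmetric]) (simp add: mult.commute)
  finally show ?thesis .
qed

text \<open>
  A string with first digit \<open>a\<close> lies at \<open>(a + x)/b\<close>, where \<open>x\<close> is the point of the remaining digits; expand
  \<open>(a + x)\<^sup>m\<close> by the binomial theorem.
\<close>

lemma block_moment_first_digit:
  assumes "b > 0"
  shows "real b ^ m * block_moment b m (Suc l) =
    (\<Sum>j\<le>m. real (m choose j) * (\<Sum>a<b. real a ^ j) * block_moment b (m - j) l)"
proof -
  have first_digit: "real b * (real (a * b ^ l + n) / real (b ^ Suc l)) = real a + real n / real (b ^ l)"
    for a n using assms by (simp add: field_simps)
  have "real b ^ m * block_moment b m (Suc l) =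
      (\<Sum>a<b. \<Sum>n<b ^ l. real b ^ m * (real (a * b ^ l + n) / real (b ^ Suc l)) ^ m)"
    unfolding block_moment_def
    by (simp only: sum_base_block_lessThan power_Suc sum_distrib_left)
  also have "\<dots> = (\<Sum>a<b. \<Sum>n<b ^ l. (real a + real n / real (b ^ l)) ^ m)"
    by (simp only: first_digit flip: power_mult_distrib)
  also have "\<dots> = (\<Sum>a<b. \<Sum>n<b ^ l. \<Sum>j\<le>m.
       real (m choose j) * real a ^ j * (real n / real (b ^ l)) ^ (m - j))"
    by (simp only: binomial_ring)
  also have "\<dots> = (\<Sum>a<b. \<Sum>j\<le>m. real (m choose j) * real a ^ j * block_moment b (m - j) l)"
    unfolding block_moment_def sum_distrib_left by (intro sum.cong refl sum.swap)
  also have "\<dots> = (\<Sum>j\<le>m. \<Sum>a<b. real (m choose j) * real a ^ j * block_moment b (m - j) l)"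
    by (rule sum.swap)
  finally show ?thesis
    by (simp add: sum_distrib_left sum_distrib_right)
qed

section \<open>The moments of the digit measure\<close>

text \<open>
  The parameter \<open>B\<close> stands for \<open>b\<^sup>s\<close>. In terms of \<open>B\<close> all arguments about moments are rational, which
  allows one treatment of real and of complex exponents; powers with such exponents have different laws
  at the two types.
\<close>

definition digit_moment :: "nat \<Rightarrow> nat \<Rightarrow> 'a \<Rightarrow> 'a::{real_normed_field, banach}" where
  "digit_moment b m B = (\<Sum>l. of_real (block_moment b m l) / B ^ l)"

lemma geometric_quotient_sums:
  fixes B :: "'a::{real_normed_field, banach}"
  assumes "norm c < norm B"
  shows "(\<lambda>l. c ^ l / B ^ l) sums (B / (B - c))"
proof -
  have B: "B \<noteq> 0" "B - c \<noteq> 0" using assms by auto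
  have "(\<lambda>l. (c / B) ^ l) sums (1 / (1 - c / B))"
    using assms B by (intro geometric_sums) (simp add: norm_divide divide_simps)
  also have "1 / (1 - c / B) = B / (B - c)"
    using B by (simp add: field_simps)
  finally show ?thesis by (simp add: power_divide)
qed

lemma summable_digit_moment:
  fixes B :: "'a::{real_normed_field, banach}"
  assumes "real b < norm B"
  shows "summable (\<lambda>l. norm (of_real (block_moment b m l) / B ^ l))"
proof (rule summable_comparison_test')
  show "summable (\<lambda>l. real b ^ l / norm B ^ l)"
    using geometric_quotient_sums [of "real b" "norm B"] assms by (auto simp: sums_iff)
  show "norm (norm (of_real (block_moment b m l) / B ^ l)) \<le> real b ^ l / norm B ^ l" for l
    using block_moment_le [of b m l] block_moment_nonneg [of b m l]
    by (simp add: norm_divide norm_power divide_right_mono)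
qed

lemma digit_moment_sums:
  fixes B :: "'a::{real_normed_field, banach}"
  assumes "real b < norm B"
  shows "(\<lambda>l. of_real (block_moment b m l) / B ^ l) sums digit_moment b m B"
  unfolding digit_moment_def
  by (rule summable_sums [OF summable_norm_cancel [OF summable_digit_moment [OF assms]]])

lemma digit_moment_0:
  fixes B :: "'a::{real_normed_field, banach}"
  assumes "real b < norm B"
  shows "digit_moment b 0 B = B / (B - of_nat b)"
  using geometric_quotient_sums [of "of_nat b" B] assms
  by (simp add: digit_moment_def sums_iff)

text \<open>
  By \<open>block_moment_bernoulli\<close> the moment is a combination of geometric series with the ratios \<open>b/B\<close>,
  \<open>1/B\<close> and \<open>b\<^sup>1\<^sup>-\<^sup>2\<^sup>k/B\<close>; the fractions are those of the definition of \<open>u\<^sub>m\<close> after cancelling powers of \<open>b\<close>.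
\<close>

lemma digit_moment_bernoulli:
  fixes B :: "'a::{real_normed_field, banach}"
  assumes "b > 1" and "real b < norm B" and "m \<ge> 1"
  shows "digit_moment b m B =
    1 / of_nat (m + 1) * (B / (B - of_nat b))
    - B * of_nat b / (2 * (B * of_nat b - of_nat b))
    + (\<Sum>k = 1..m div 2.
         fact m / fact (m - 2 * k + 1) * (of_real (bernoulli (2 * k)) / fact (2 * k))
         * (B * of_nat b ^ (2 * k) / (B * of_nat b ^ (2 * k) - of_nat b)))"
proof -
  have B: "B \<noteq> 0" using assms by auto
  define c :: "nat \<Rightarrow> 'a" where "c k = of_nat b / of_nat b ^ (2 * k)" for k
  define w :: "nat \<Rightarrow> 'a" where
    "w k = fact m / fact (m - 2 * k + 1) * (of_real (bernoulli (2 * k)) / fact (2 * k))" for k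
  have nc: "norm (c k) < norm B" if "k \<ge> 1" for k
  proof -
    have "norm (c k) = real b / real b ^ (2 * k)"
      by (simp add: c_def norm_divide norm_power)
    also have "\<dots> \<le> real b / 1"
      using assms by (intro divide_left_mono) (auto intro!: one_le_power)
    finally show ?thesis using assms by simp
  qed
  have "(\<lambda>l. 1 / of_nat (m + 1) * (of_nat b ^ l / B ^ l) - 1 / 2 * (1 ^ l / B ^ l)
           + (\<Sum>k = 1..m div 2. w k * (c k ^ l / B ^ l)))
      sums (1 / of_nat (m + 1) * (B / (B - of_nat b)) - 1 / 2 * (B / (B - 1))
           + (\<Sum>k = 1..m div 2. w k * (B / (B - c k))))"
    by (intro sums_add sums_diff sums_mult sums_sum geometric_quotient_sums nc)
       (use assms in auto)
  also have "(\<lambda>l. 1 / of_nat (m + 1) * (of_nat b ^ l / B ^ l) - 1 / 2 * (1 ^ l / B ^ l)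
           + (\<Sum>k = 1..m div 2. w k * (c k ^ l / B ^ l)))
      = (\<lambda>l. of_real (block_moment b m l) / B ^ l)"
  proof
    fix l
    have "of_real (block_moment b m l) = 1 / of_nat (m + 1) * of_nat b ^ l - 1 / 2
           + (\<Sum>k = 1..m div 2. w k * c k ^ l)"
      using assms by (simp add: block_moment_bernoulli w_def c_def)
    then show "1 / of_nat (m + 1) * (of_nat b ^ l / B ^ l) - 1 / 2 * (1 ^ l / B ^ l)
           + (\<Sum>k = 1..m div 2. w k * (c k ^ l / B ^ l)) = of_real (block_moment b m l) / B ^ l"
      by (simp add: add_divide_distrib diff_divide_distrib sum_divide_distrib)
  qed
  finally have "digit_moment b m B = 1 / of_nat (m + 1) * (B / (B - of_nat b))
      - 1 / 2 * (B / (B - 1)) + (\<Sum>k = 1..m div 2. w k * (B / (B - c k)))"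
    by (simp add: digit_moment_def sums_iff)
  also have "1 / 2 * (B / (B - 1)) = B * of_nat b / (2 * (B * of_nat b - of_nat b))"
  proof -
    have "B * of_nat b - of_nat b = (B - 1) * of_nat b" by (simp add: algebra_simps)
    then show ?thesis using assms by simp
  qed
  also have "(\<Sum>k = 1..m div 2. w k * (B / (B - c k))) = (\<Sum>k = 1..m div 2. w k
         * (B * of_nat b ^ (2 * k) / (B * of_nat b ^ (2 * k) - of_nat b)))"
  proof (intro sum.cong refl)
    fix k
    have "B * of_nat b ^ (2 * k) - of_nat b = (B - c k) * of_nat b ^ (2 * k)"
      using assms by (simp add: c_def algebra_simps)
    then show "w k * (B / (B - c k)) =
        w k * (B * of_nat b ^ (2 * k) / (B * of_nat b ^ (2 * k) - of_nat b))"
      using assms by simp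
  qed
  finally show ?thesis by (simp only: w_def)
qed

lemma norm_base_powr:
  assumes "b > 0"
  shows "norm (of_nat b powr s :: complex) = real b powr Re s"
  using assms norm_powr_real_powr [of "of_nat b" s] by simp

lemma less_base_powr:
  assumes "b > 1" and "\<sigma> > 1"
  shows "real b < real b powr \<sigma>"
  using assms powr_less_mono [of 1 \<sigma> "real b"] by simp

lemma u_coeff_complex_eq_digit_moment:
  fixes s :: complex
  assumes "b > 1" and "Re s > 1"
  shows "u_coeff b m s = digit_moment b m (of_nat b powr s)"
proof -
  have B: "real b < norm (of_nat b powr s)"
    using assms less_base_powr norm_base_powr by simp
  have [simp]: "of_nat b powr (s + 1) = of_nat b powr s * of_nat b"
    "of_nat b powr (s + of_nat j) = of_nat b powr s * of_nat b ^ j" for j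
    using assms by (simp_all add: powr_add)
  show ?thesis
    using digit_moment_bernoulli [OF assms(1) B, of m] digit_moment_0 [OF B]
    by (simp add: u_coeff_def del: of_nat_mult of_nat_numeral)
qed

lemma u_coeff_real_eq_digit_moment:
  fixes \<sigma> :: real
  assumes "b > 1" and "\<sigma> > 1"
  shows "u_coeff b m \<sigma> = digit_moment b m (of_nat b powr \<sigma>)"
proof -
  have B: "real b < norm (of_nat b powr \<sigma>)"
    using assms less_base_powr by simp
  have [simp]: "of_nat b powr (\<sigma> + 1) = of_nat b powr \<sigma> * of_nat b"
    "of_nat b powr (\<sigma> + of_nat j) = of_nat b powr \<sigma> * of_nat b ^ j" for j
    using assms by (simp_all add: powr_add powr_realpow)
  show ?thesis
    using digit_moment_bernoulli [OF assms(1) B, of m] digit_moment_0 [OF B]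
    by (simp add: u_coeff_def del: of_nat_mult of_nat_numeral)
qed

lemma digit_moment_increment_sums:
  fixes B :: "'a::{real_normed_field, banach}"
  assumes "real b < norm B"
  shows "(\<lambda>l. of_real (block_moment b m (Suc l)) / B ^ l)
           sums (B * (digit_moment b m B - of_real (block_moment b m 0)))"
proof -
  have "(\<lambda>l. of_real (block_moment b m (Suc l)) / B ^ Suc l)
           sums (digit_moment b m B - of_real (block_moment b m 0))"
    using digit_moment_sums [OF assms, of m]
    by (subst sums_Suc_iff [of "\<lambda>l. of_real (block_moment b m l) / B ^ l"]) simp
  then have "(\<lambda>l. B * (of_real (block_moment b m (Suc l)) / B ^ Suc l))
           sums (B * (digit_moment b m B - of_real (block_moment b m 0)))"
    by (rule sums_mult)
  moreover have "B \<noteq> 0" using assms by auto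
  ultimately show ?thesis by simp
qed

text \<open>
  As a series in powers of \<open>B\<close>, \<open>(B - b) u\<^sub>m\<close> has the differences \<open>d l\<close> of the proof as coefficients of
  \<open>B\<^sup>-\<^sup>l\<close>, preceded by \<open>B\<close> itself if \<open>m = 0\<close>. They are nonnegative by \<open>block_moment_last_digit\<close>, and the triangle
  inequality bounds such a series by its value at \<open>|B|\<close>.
\<close>

lemma norm_digit_moment_le:
  fixes B :: "'a::{real_normed_field, banach}"
  assumes "b > 0" and "real b < norm B"
  shows "norm ((B - of_nat b) * digit_moment b m B)
           \<le> (norm B - real b) * digit_moment b m (norm B)"
proof -
  define d where "d l = block_moment b m (Suc l) - real b * block_moment b m l" for l
  have d: "d l \<ge> 0" for l
    using block_moment_last_digit [OF assms(1)] by (simp add: d_def)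
  have sums: "(\<lambda>l. of_real (d l) / z ^ l) sums
      ((z - of_nat b) * digit_moment b m z - z * of_real (block_moment b m 0))"
    if "real b < norm z" for z :: "'b::{real_normed_field, banach}"
  proof -
    have "(\<lambda>l. of_real (block_moment b m (Suc l)) / z ^ l
             - of_nat b * (of_real (block_moment b m l) / z ^ l)) sums
          (z * (digit_moment b m z - of_real (block_moment b m 0)) - of_nat b * digit_moment b m z)"
      by (intro sums_diff sums_mult digit_moment_increment_sums digit_moment_sums that)
    then show ?thesis
      by (simp add: d_def algebra_simps diff_divide_distrib)
  qed
  have B: "real b < norm (norm B)" using assms by simp
  have "norm (of_real (d l) / B ^ l) \<le> of_real (d l) / norm B ^ l" for l
    using d by (simp add: norm_divide norm_power)
  then have "norm ((B - of_nat b) * digit_moment b m B - B * of_real (block_moment b m 0))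
      \<le> (norm B - real b) * digit_moment b m (norm B) - norm B * block_moment b m 0"
    using norm_suminf_le [of "\<lambda>l. of_real (d l) / B ^ l" "\<lambda>l. of_real (d l) / norm B ^ l"]
      sums [OF assms(2)] sums [OF B] by (simp add: sums_iff)
  moreover have "norm (B * of_real (block_moment b m 0)) = norm B * block_moment b m 0"
    using block_moment_nonneg by (simp add: norm_mult)
  ultimately show ?thesis
    using norm_triangle_sub [of "(B - of_nat b) * digit_moment b m B" "B * of_real (block_moment b m 0)"]
    by linarith
qed

text \<open>
  Sum \<open>block_moment_first_digit\<close> over all levels with the weights \<open>B\<^sup>-\<^sup>l\<close>. The empty string sits at \<open>0\<close> and does
  not contribute for \<open>m \<ge> 1\<close>; the term \<open>j = 0\<close> is \<open>b u\<^sub>m\<close> and has been moved to the left.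
\<close>

lemma digit_moment_recurrence:
  fixes B :: "'a::{real_normed_field, banach}"
  assumes "b > 0" and "real b < norm B" and "m \<ge> 1"
  shows "(B * of_nat b ^ m - of_nat b) * digit_moment b m B =
    (\<Sum>j = 1..m. of_nat (m choose j) * (\<Sum>a<b. of_nat a ^ j) * digit_moment b (m - j) B)"
proof -
  define w :: "nat \<Rightarrow> 'a" where "w j = of_nat (m choose j) * (\<Sum>a<b. of_nat a ^ j)" for j
  have "(\<lambda>l. of_nat b ^ m * (of_real (block_moment b m (Suc l)) / B ^ l)) sums
      (of_nat b ^ m * (B * (digit_moment b m B - of_real (block_moment b m 0))))"
    by (intro sums_mult digit_moment_increment_sums assms)
  moreover have "of_nat b ^ m * (of_real (block_moment b m (Suc l)) / B ^ l)
      = (\<Sum>j\<le>m. w j * (of_real (block_moment b (m - j) l) / B ^ l))" for l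
  proof -
    have "of_nat b ^ m * of_real (block_moment b m (Suc l)) =
        (\<Sum>j\<le>m. w j * of_real (block_moment b (m - j) l))"
      using arg_cong [OF block_moment_first_digit [OF assms(1), of m l], of "of_real :: real \<Rightarrow> 'a"]
      by (simp add: w_def)
    then show ?thesis
      by (simp add: sum_divide_distrib)
  qed
  ultimately have "(\<lambda>l. \<Sum>j\<le>m. w j * (of_real (block_moment b (m - j) l) / B ^ l)) sums
      (of_nat b ^ m * (B * (digit_moment b m B - of_real (block_moment b m 0))))"
    by simp
  moreover have "(\<lambda>l. \<Sum>j\<le>m. w j * (of_real (block_moment b (m - j) l) / B ^ l)) sums
      (\<Sum>j\<le>m. w j * digit_moment b (m - j) B)"
    by (intro sums_sum sums_mult digit_moment_sums assms)
  ultimately have "of_nat b ^ m * B * digit_moment b m B = (\<Sum>j\<le>m. w j * digit_moment b (m - j) B)"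
    using assms(3) by (simp add: sums_iff block_moment_level_0 mult.assoc)
  also have "\<dots> = w 0 * digit_moment b m B + (\<Sum>j = 1..m. w j * digit_moment b (m - j) B)"
    by (simp add: sum.atLeast_Suc_atMost flip: atLeast0AtMost)
  finally show ?thesis
    by (simp add: w_def algebra_simps)
qed

lemma pochhammer_split_descending:
  fixes s :: "'a::comm_ring_1"
  assumes "j \<le> m"
  shows "pochhammer (s + 1) m = pochhammer (s + 1) (m - j) * (\<Prod>i<j. s + of_nat m - of_nat i)"
proof -
  have "pochhammer (s + 1 + of_nat (m - j)) j = (\<Prod>i<j. s + 1 + of_nat (m - j) + of_nat i)"
    by (simp add: pochhammer_prod atLeast0LessThan)
  also have "\<dots> = (\<Prod>i<j. s + 1 + of_nat (m - j) + of_nat (j - Suc i))"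
    by (rule prod.nat_diff_reindex [symmetric])
  also have "\<dots> = (\<Prod>i<j. s + of_nat m - of_nat i)"
    using assms by (intro prod.cong refl) (simp add: of_nat_diff)
  finally show ?thesis
    using pochhammer_product [of "m - j" m "s + 1"] assms by simp
qed

lemma u_star_recurrence:
  fixes s :: complex
  assumes "b > 1" and "Re s > 1" and "m \<ge> 1"
  shows "u_star b m s =
        1 / (of_nat b powr (of_nat m + s) - of_nat b)
        * (\<Sum>j = 1..m. (\<Prod>i<j. s + of_nat m - of_nat i) / fact j
             * u_star b (m - j) s * (\<Sum>a<b. of_nat a ^ j))"
proof -
  define B where "B = of_nat b powr s"
  have B: "real b < norm B"
    unfolding B_def using assms less_base_powr norm_base_powr by simp
  have Bm: "of_nat b powr (of_nat m + s) = B * of_nat b ^ m"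
    using assms by (simp add: powr_add B_def)
  have "real b * 1 < norm B * real b ^ m"
    using B assms by (intro mult_less_le_imp_less) (auto intro!: one_le_power)
  then have nz: "B * of_nat b ^ m - of_nat b \<noteq> 0"
    by (metis mult.right_neutral norm_mult norm_of_nat norm_power order_less_irrefl right_minus_eq)
  have recurrence: "(B * of_nat b ^ m - of_nat b) * digit_moment b m B =
      (\<Sum>j = 1..m. of_nat (m choose j) * (\<Sum>a<b. of_nat a ^ j) * digit_moment b (m - j) B)"
    using assms by (intro digit_moment_recurrence B) auto
  have u: "u_star b k s = pochhammer (s + 1) k / fact k * digit_moment b k B" for k
    using assms by (simp add: u_star_def u_coeff_complex_eq_digit_moment B_def)
  have summand: "pochhammer (s + 1) m / fact m *
         (of_nat (m choose j) * (\<Sum>a<b. of_nat a ^ j) * digit_moment b (m - j) B)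
       = (\<Prod>i<j. s + of_nat m - of_nat i) / fact j * u_star b (m - j) s * (\<Sum>a<b. of_nat a ^ j)"
    if "j \<in> {1..m}" for j
  proof -
    have "j \<le> m" using that by simp
    then show ?thesis
      using pochhammer_split_descending [of j m s]
      by (simp add: u binomial_fact divide_simps)
  qed
  have "(B * of_nat b ^ m - of_nat b) * u_star b m s = pochhammer (s + 1) m / fact m *
     ((B * of_nat b ^ m - of_nat b) * digit_moment b m B)"
    by (simp add: u)
  also have "\<dots> = (\<Sum>j = 1..m. pochhammer (s + 1) m / fact m *
         (of_nat (m choose j) * (\<Sum>a<b. of_nat a ^ j) * digit_moment b (m - j) B))"
    by (simp only: recurrence sum_distrib_left [of "pochhammer (s + 1) m / fact m"])
  also have "\<dots> = (\<Sum>j = 1..m. (\<Prod>i<j. s + of_nat m - of_nat i) / fact j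
             * u_star b (m - j) s * (\<Sum>a<b. of_nat a ^ j))"
    using summand by (rule sum.cong [OF refl])
  finally have eq: "(B * of_nat b ^ m - of_nat b) * u_star b m s = \<dots>" .
  show ?thesis
    unfolding Bm eq [symmetric] using nz by simp
qed

section \<open>Two-sided bounds at real exponents\<close>

text \<open>
  After the reflection \<open>x \<mapsto> 1 - x\<close> the mass is on the points \<open>k/b\<^sup>l\<close> with \<open>1 \<le> k \<le> b\<^sup>l\<close>, so that the
  number of points in \<open>[0,x]\<close> is simply \<open>\<lfloor>b\<^sup>l x\<rfloor>\<close>.
\<close>

lemma block_moment_reflect:
  assumes "b > 0"
  shows "block_moment b m l = (\<Sum>k = 1..b ^ l. (1 - real k / real (b ^ l)) ^ m)"
proof -
  have "block_moment b m l = (\<Sum>k = 1..b ^ l. (real (b ^ l - k) / real (b ^ l)) ^ m)"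
    unfolding block_moment_def
    by (rule sum.reindex_bij_witness [of _ "\<lambda>k. b ^ l - k" "\<lambda>n. b ^ l - n"]) auto
  also have "\<dots> = (\<Sum>k = 1..b ^ l. (1 - real k / real (b ^ l)) ^ m)"
    using assms by (intro sum.cong refl) (simp add: of_nat_diff diff_divide_distrib)
  finally show ?thesis .
qed

text \<open>
  This represents \<open>(1 - t)\<^sup>m\<close> as an average of indicator functions of \<open>[0,x]\<close>, evaluated at \<open>t\<close>. It replaces an
  integration by parts against a distribution function.
\<close>

lemma has_integral_truncated_power:
  fixes t :: real
  assumes "0 \<le> t" "t \<le> 1" "m \<ge> 1"
  shows "((\<lambda>x. if t \<le> x then real m * (1 - x) ^ (m - 1) else 0) has_integral (1 - t) ^ m) {0..1}"
proof -
  have "((\<lambda>x. real m * (1 - x) ^ (m - 1)) has_integral (- ((1 - 1) ^ m) - (- ((1 - t) ^ m)))) {t..1}"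
    using assms
    by (intro fundamental_theorem_of_calculus)
       (auto intro!: derivative_eq_intros simp flip: has_real_derivative_iff_has_vector_derivative)
  then have "((\<lambda>x. real m * (1 - x) ^ (m - 1)) has_integral (1 - t) ^ m) {t..1}"
    using assms by (simp add: power_0_left)
  then have "((\<lambda>x. if x \<in> {t..1} then real m * (1 - x) ^ (m - 1) else 0) has_integral (1 - t) ^ m) {0..1}"
    using assms by (subst has_integral_restrict) auto
  then show ?thesis
    by (rule has_integral_eq [rotated]) auto
qed

text \<open>
  The Beta integral \<open>m B(\<sigma> + 1, m)\<close>.
\<close>

lemma has_integral_powr_power:
  fixes \<sigma> :: real
  assumes "\<sigma> > 0" "m \<ge> 1"
  shows "((\<lambda>x. x powr \<sigma> * (real m * (1 - x) ^ (m - 1)))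
           has_integral fact m / pochhammer (\<sigma> + 1) m) {0..1}"
proof -
  obtain n where m: "m = Suc n" using assms by (cases m) auto
  have "((\<lambda>x. x powr (\<sigma> + 1 - 1) * (1 - x) powr (real m - 1)) has_integral Beta (\<sigma> + 1) (real m)) {0..1}"
    using assms by (intro has_integral_Beta_real) auto
  then have "((\<lambda>x. real m * (x powr \<sigma> * (1 - x) powr real n)) has_integral
      real m * Beta (\<sigma> + 1) (real m)) {0<..<1}"
    by (subst (asm) has_integral_Icc_iff_Ioo) (simp add: m has_integral_mult_right)
  then have "((\<lambda>x. x powr \<sigma> * (real m * (1 - x) ^ (m - 1))) has_integral
      real m * Beta (\<sigma> + 1) (real m)) {0<..<1}"
    by (rule has_integral_eq [rotated]) (simp add: powr_realpow m)
  moreover have "real m * Beta (\<sigma> + 1) (real m) = fact m / pochhammer (\<sigma> + 1) m"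
  proof -
    have "\<sigma> + 1 \<notin> \<int>\<^sub>\<le>\<^sub>0" using assms by (auto elim!: nonpos_Ints_cases)
    then have "pochhammer (\<sigma> + 1) m = Gamma (\<sigma> + 1 + real m) / Gamma (\<sigma> + 1)"
      by (rule pochhammer_Gamma)
    moreover have "real m * Gamma (real m) = fact m"
      using Gamma_fact [of n, where 'a = real] by (simp add: m add.commute)
    ultimately show ?thesis
      by (simp add: Beta_def)
  qed
  ultimately show ?thesis
    by (simp only: has_integral_Icc_iff_Ioo)
qed

text \<open>
  Valid also for \<open>L < p\<close>, which spares case distinctions between the scale \<open>p\<close> of a point and the
  truncation level \<open>L\<close>.
\<close>

lemma geometric_window_sum:
  fixes r :: real
  shows "(1 - r) * (\<Sum>l<L. if p \<le> l then r ^ l else 0) = (if p \<le> L then r ^ p - r ^ L else 0)"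
proof (induction L)
  case (Suc L)
  have "(1 - r) * (\<Sum>l<Suc L. if p \<le> l then r ^ l else 0) =
      (1 - r) * (\<Sum>l<L. if p \<le> l then r ^ l else 0) + (1 - r) * (if p \<le> L then r ^ L else 0)"
    by (simp add: distrib_left)
  also have "\<dots> = (if p \<le> Suc L then r ^ p - r ^ Suc L else 0)"
    unfolding Suc.IH by (cases "p \<le> L"; cases "p = Suc L") (auto simp: left_diff_distrib)
  finally show ?case .
qed auto

text \<open>
  The distribution function of the reflected digit measure, restricted to the levels below \<open>L\<close>. Working with
  finitely many levels keeps all integrals elementary; the limit \<open>L \<rightarrow> \<infinity>\<close> is taken after integration.
\<close>

definition counting_sum :: "nat \<Rightarrow> real \<Rightarrow> nat \<Rightarrow> real \<Rightarrow> real" where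
  "counting_sum b B L x = (\<Sum>l<L. real (nat \<lfloor>real (b ^ l) * x\<rfloor>) / B ^ l)"

lemma sum_block_moment_has_integral:
  assumes "b > 0" "m \<ge> 1"
  shows "((\<lambda>x. counting_sum b B L x * (real m * (1 - x) ^ (m - 1)))
           has_integral (\<Sum>l<L. block_moment b m l / B ^ l)) {0..1}"
proof -
  define g where "g x = real m * (1 - x) ^ (m - 1)" for x :: real
  have "((\<lambda>x. \<Sum>l<L. (\<Sum>k = 1..b ^ l. if real k / real (b ^ l) \<le> x then g x else 0) / B ^ l)
      has_integral (\<Sum>l<L. (\<Sum>k = 1..b ^ l. (1 - real k / real (b ^ l)) ^ m) / B ^ l)) {0..1}"
    unfolding g_def using assms
    by (intro has_integral_sum has_integral_divide has_integral_truncated_power)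
       (auto simp: divide_simps simp del: of_nat_power)
  then have "((\<lambda>x. \<Sum>l<L. (\<Sum>k = 1..b ^ l. if real k / real (b ^ l) \<le> x then g x else 0) / B ^ l)
      has_integral (\<Sum>l<L. block_moment b m l / B ^ l)) {0..1}"
    using assms by (simp only: block_moment_reflect)
  moreover have "(\<Sum>k = 1..b ^ l. if real k / real (b ^ l) \<le> x then g x else 0)
      = real (nat \<lfloor>real (b ^ l) * x\<rfloor>) * g x" if x: "x \<in> {0..1}" for x l
  proof -
    define N where "N = b ^ l"
    have N: "N > 0" using assms by (simp add: N_def)
    have "{k \<in> {1..N}. real k / real N \<le> x} = {1..nat \<lfloor>real N * x\<rfloor>}"
    proof (intro set_eqI iffI)
      fix k assume "k \<in> {k \<in> {1..N}. real k / real N \<le> x}"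
      then show "k \<in> {1..nat \<lfloor>real N * x\<rfloor>}"
        using N by (auto simp: field_simps le_nat_floor)
    next
      fix k assume k: "k \<in> {1..nat \<lfloor>real N * x\<rfloor>}"
      then have "real k \<le> real N * x"
        using x N by (metis atLeastAtMost_iff le_nat_floor of_nat_0_le_iff of_nat_mono of_nat_floor
            order_trans mult_nonneg_nonneg)
      moreover have "real N * x \<le> real N"
        using x N by (simp add: mult_left_le)
      ultimately have "k \<le> N" "real k / real N \<le> x"
        using N by (linarith, simp add: field_simps)
      then show "k \<in> {k \<in> {1..N}. real k / real N \<le> x}"
        using k by simp
    qed
    then have "(\<Sum>k = 1..N. if real k / real N \<le> x then g x else 0) = (\<Sum>k = 1..nat \<lfloor>real N * x\<rfloor>. g x)"
      by (simp only: sum.inter_filter [symmetric] finite_atLeastAtMost)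
    then show ?thesis by (simp add: N_def)
  qed
  ultimately show ?thesis
    unfolding counting_sum_def g_def [symmetric]
    by (elim has_integral_eq [rotated]) (simp add: sum_distrib_right)
qed

text \<open>
  The \<open>p\<close> with \<open>b\<^sup>-\<^sup>p \<le> x < b\<^sup>1\<^sup>-\<^sup>p\<close> (for \<open>x = 1\<close> it is \<open>0\<close>): level \<open>p\<close> is the first to have a point in \<open>(0,x]\<close>.
\<close>

lemma exists_digit_scale:
  fixes x :: real
  assumes "b > 1" "0 < x" "x \<le> 1"
  obtains p :: nat where "1 \<le> real b ^ p * x" and "\<And>l. l < p \<Longrightarrow> real b ^ l * x < 1"
proof -
  obtain n where "1 / x < real b ^ n"
    using real_arch_pow [of "real b" "1 / x"] assms by auto
  then have ex: "1 \<le> real b ^ n * x" using assms by (simp add: field_simps)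
  define p where "p = (LEAST p. 1 \<le> real b ^ p * x)"
  have "1 \<le> real b ^ p * x" unfolding p_def using ex by (rule LeastI)
  moreover have "real b ^ l * x < 1" if "l < p" for l
    using not_less_Least [of l "\<lambda>p. 1 \<le> real b ^ p * x"] that by (simp add: p_def)
  ultimately show ?thesis using that by blast
qed

text \<open>
  Only levels \<open>l \<ge> p\<close> count, with \<open>p\<close> the scale of \<open>x\<close>. There \<open>\<lfloor>b\<^sup>l x\<rfloor> \<le> b\<^sup>l x\<close>, so the sum is at most
  \<open>x (b/B)\<^sup>p B/(B - b)\<close>, and \<open>(b/B)\<^sup>p = (b\<^sup>p)\<^sup>1\<^sup>-\<^sup>\<sigma> \<le> x\<^sup>\<sigma>\<^sup>-\<^sup>1\<close> because \<open>b\<^sup>p \<ge> 1/x\<close>.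
\<close>

lemma counting_sum_le:
  fixes b :: nat and \<sigma> B :: real
  defines "B \<equiv> real b powr \<sigma>"
  assumes "b > 1" "\<sigma> > 1" "0 \<le> x" "x \<le> 1"
  shows "counting_sum b B L x \<le> B / (B - b) * x powr \<sigma>"
proof (cases "x = 0")
  case True
  then show ?thesis by (simp add: counting_sum_def)
next
  case False
  then have x: "0 < x" using assms by simp
  have B: "B > b" "B > 0" using less_base_powr assms by (auto simp: B_def)
  define r where "r = b / B"
  have r: "0 < r" "r < 1" using B assms by (auto simp: r_def)
  obtain p where p: "1 \<le> real b ^ p * x" "\<And>l. l < p \<Longrightarrow> real b ^ l * x < 1"
    using exists_digit_scale [OF \<open>b > 1\<close> x \<open>x \<le> 1\<close>] by blast
  have "real (nat \<lfloor>real (b ^ l) * x\<rfloor>) / B ^ l \<le> x * (if p \<le> l then r ^ l else 0)" for l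
  proof (cases "p \<le> l")
    case True
    have "real (nat \<lfloor>real (b ^ l) * x\<rfloor>) \<le> real (b ^ l) * x"
      using x by (simp add: of_nat_floor)
    then have "real (nat \<lfloor>real (b ^ l) * x\<rfloor>) / B ^ l \<le> real (b ^ l) * x / B ^ l"
      using B by (intro divide_right_mono) auto
    then show ?thesis using True by (simp add: r_def power_divide mult.commute)
  next
    case False
    then have "\<lfloor>real b ^ l * x\<rfloor> \<le> 0"
      using p(2) [of l] by (simp add: floor_le_iff)
    then show ?thesis using False by simp
  qed
  then have "counting_sum b B L x \<le> x * (\<Sum>l<L. if p \<le> l then r ^ l else 0)"
    unfolding counting_sum_def sum_distrib_left by (intro sum_mono)
  also have "(\<Sum>l<L. if p \<le> l then r ^ l else 0) = (if p \<le> L then r ^ p - r ^ L else 0) / (1 - r)"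
    using geometric_window_sum [of r p L] r by (simp add: field_simps)
  also have "\<dots> \<le> r ^ p / (1 - r)"
    using r by (intro divide_right_mono) auto
  also have "r ^ p = (real b ^ p) powr (1 - \<sigma>)"
    using assms by (simp add: r_def B_def powr_diff powr_power powr_powr power_divide
        mult.commute flip: powr_realpow)
  also have "\<dots> \<le> (1 / x) powr (1 - \<sigma>)"
    using p x assms by (intro powr_mono2') (auto simp: field_simps)
  also have "(1 / x) powr (1 - \<sigma>) = x powr \<sigma> / x"
    using x by (simp add: powr_diff powr_divide)
  also have "x * (x powr \<sigma> / x / (1 - r)) = B / (B - b) * x powr \<sigma>"
    using x B by (simp add: r_def field_simps)
  finally show ?thesis using x r by (simp add: divide_right_mono)
qed

text \<open>
  If \<open>b\<^sup>p x \<ge> 1\<close>, then \<open>\<lfloor>b\<^sup>l x\<rfloor> \<ge> b\<^sup>l\<^sup>-\<^sup>p\<close> for \<open>l \<ge> p\<close>, and all levels together give at least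
  \<open>B\<^sup>1\<^sup>-\<^sup>p/(B - b)\<close>. With \<open>p\<close> the scale of \<open>x\<close> this exceeds \<open>x\<^sup>\<sigma>/(B - b)\<close> since \<open>x < b\<^sup>1\<^sup>-\<^sup>p\<close>. The summand \<open>1 - x\<close>
  on \<open>[1/b, 1]\<close> records some of the excess, so that strictness survives the limit \<open>L \<rightarrow> \<infinity>\<close>; the subtracted term
  bounds the omitted levels.
\<close>

lemma counting_sum_ge:
  fixes b :: nat and \<sigma> B :: real
  defines "B \<equiv> real b powr \<sigma>"
  assumes "b > 1" "\<sigma> > 1" "0 \<le> x" "x \<le> 1"
  shows "1 / (B - b) * (x powr \<sigma> + (if 1 / real b \<le> x then 1 - x else 0)) - (b / B) ^ L * (B / (B - b))
           \<le> counting_sum b B L x"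
proof -
  have B: "B > b" "B > 0" using less_base_powr assms by (auto simp: B_def)
  define r where "r = b / B"
  have r: "0 < r" "r < 1" using B assms by (auto simp: r_def)
  have *: "B / B ^ p / (B - b) - r ^ L * (B / (B - b)) \<le> counting_sum b B L x"
    if p: "1 \<le> real b ^ p * x" for p
  proof -
    have "1 / real b ^ p * (if p \<le> l then r ^ l else 0) \<le> real (nat \<lfloor>real (b ^ l) * x\<rfloor>) / B ^ l" for l
    proof (cases "p \<le> l")
      case True
      have "real b ^ (l - p) * 1 \<le> real b ^ (l - p) * (real b ^ p * x)"
        using p by (intro mult_left_mono) auto
      also have "\<dots> = real (b ^ l) * x"
        using True by (simp add: mult.assoc flip: power_add)
      finally have "b ^ (l - p) \<le> nat \<lfloor>real (b ^ l) * x\<rfloor>"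
        by (intro le_nat_floor) simp
      then have "real (b ^ (l - p)) / B ^ l \<le> real (nat \<lfloor>real (b ^ l) * x\<rfloor>) / B ^ l"
        using B by (intro divide_right_mono) (simp_all only: of_nat_le_iff, simp)
      moreover have "real (b ^ (l - p)) / B ^ l = 1 / real b ^ p * r ^ l"
      proof -
        have "real b ^ (l - p) = real b ^ l / real b ^ p"
          using True assms by (simp add: power_diff)
        then show ?thesis by (simp add: r_def power_divide)
      qed
      ultimately show ?thesis using True by simp
    qed (use B in auto)
    then have "1 / real b ^ p * (\<Sum>l<L. if p \<le> l then r ^ l else 0) \<le> counting_sum b B L x"
      unfolding counting_sum_def sum_distrib_left by (intro sum_mono)
    moreover have "(r ^ p - r ^ L) / (1 - r) \<le> (\<Sum>l<L. if p \<le> l then r ^ l else 0)"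
    proof -
      have "r ^ p - r ^ L \<le> (1 - r) * (\<Sum>l<L. if p \<le> l then r ^ l else 0)"
        using r by (auto simp: geometric_window_sum intro: power_decreasing)
      then show ?thesis using r by (simp add: field_simps)
    qed
    then have "1 / real b ^ p * ((r ^ p - r ^ L) / (1 - r)) \<le>
        1 / real b ^ p * (\<Sum>l<L. if p \<le> l then r ^ l else 0)"
      using assms by (intro mult_left_mono) auto
    moreover have "1 / real b ^ p * ((r ^ p - r ^ L) / (1 - r)) =
        B / B ^ p / (B - b) - r ^ L * (B / (B - b)) / real b ^ p"
    proof -
      have "1 / (1 - r) = B / (B - b)" using B by (simp add: r_def field_simps)
      then have "1 / real b ^ p * ((r ^ p - r ^ L) / (1 - r)) =
          1 / real b ^ p * ((r ^ p - r ^ L) * (B / (B - b)))"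
        by (metis times_divide_eq_right mult.right_neutral)
      also have "\<dots> = (r ^ p / real b ^ p) * (B / (B - b)) - r ^ L * (B / (B - b)) / real b ^ p"
        by (simp add: algebra_simps)
      also have "r ^ p / real b ^ p = 1 / B ^ p"
        using assms by (simp add: r_def power_divide)
      finally show ?thesis by simp
    qed
    moreover have "r ^ L * (B / (B - b)) / real b ^ p \<le> r ^ L * (B / (B - b)) / 1"
      using r B assms by (intro divide_left_mono) (auto intro!: one_le_power)
    ultimately show ?thesis by linarith
  qed
  \<comment> \<open>The scale \<open>p = 1\<close> serves for all of \<open>[1/b, 1]\<close>, including \<open>x = 1\<close>.\<close>
  consider "x = 0" | "1 / real b \<le> x" | "0 < x" "x < 1 / real b"
    using assms by fastforce
  then have "\<exists>y. 1 / (B - b) * (x powr \<sigma> + (if 1 / real b \<le> x then 1 - x else 0)) \<le> y \<and>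
     y - r ^ L * (B / (B - b)) \<le> counting_sum b B L x"
  proof cases
    case 1
    have "0 \<le> r ^ L * (B / (B - b))" using r B by simp
    then show ?thesis
      using 1 assms by (intro exI [of _ 0]) (simp add: counting_sum_def)
  next
    case 2
    have "x powr \<sigma> \<le> x powr 1"
      using assms by (intro powr_mono') auto
    then have "x powr \<sigma> + (1 - x) \<le> 1" using assms by simp
    then have "1 / (B - b) * (x powr \<sigma> + (1 - x)) \<le> 1 / (B - b) * 1"
      using B by (intro mult_left_mono) auto
    moreover have "1 / (B - b) - r ^ L * (B / (B - b)) \<le> counting_sum b B L x"
      using * [of 1] 2 B assms by (simp add: field_simps)
    ultimately show ?thesis using 2 by auto
  next
    case 3
    then obtain p where p: "1 \<le> real b ^ p * x" "\<And>l. l < p \<Longrightarrow> real b ^ l * x < 1"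
      using exists_digit_scale [OF \<open>b > 1\<close>, of x] assms by blast
    have "1 / real b < 1" using assms by simp
    then have "p \<noteq> 0" using p(1) 3 by (intro notI) simp
    then obtain q where q: "p = Suc q" by (cases p) auto
    have "x \<le> 1 / real b ^ q" using p(2) [of q] q assms by (simp add: field_simps)
    then have "x powr \<sigma> \<le> (1 / real b ^ q) powr \<sigma>"
      using assms by (intro powr_mono2) auto
    also have "\<dots> = B / B ^ p"
      using assms B by (simp add: B_def q powr_divide powr_powr powr_power mult.commute flip: powr_realpow)
    finally have "1 / (B - b) * x powr \<sigma> \<le> 1 / (B - b) * (B / B ^ p)"
      using B by (intro mult_left_mono) auto
    then show ?thesis
      using * [OF p(1)] 3 by (intro exI [of _ "B / B ^ p / (B - b)"]) (auto simp: mult.commute)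
  qed
  then show ?thesis unfolding r_def by linarith
qed

text \<open>
  Integrate the two bounds on the distribution function against \<open>m (1 - x)\<^sup>m\<^sup>-\<^sup>1\<close> and let the number of levels
  tend to infinity. For \<open>m = 0\<close>, where this weight vanishes, the value is known in closed form.
\<close>

lemma digit_moment_bounds:
  fixes b :: nat and \<sigma> B :: real
  defines "B \<equiv> real b powr \<sigma>"
  assumes "b > 1" "\<sigma> > 1"
  shows "1 / (B - b) * (fact m / pochhammer (\<sigma> + 1) m) < digit_moment b m B"
    and "digit_moment b m B \<le> B / (B - b) * (fact m / pochhammer (\<sigma> + 1) m)"
proof -
  have B: "B > b" "B > 0" using less_base_powr assms by (auto simp: B_def)
  have nB: "real b < norm B" using B by simp
  define P where "P = fact m / pochhammer (\<sigma> + 1) m"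
  define c where "c = 1 / (B - b)"
  have c: "c > 0" using B by (simp add: c_def)
  have "c * P < digit_moment b m B \<and> digit_moment b m B \<le> B * c * P"
  proof (cases "m = 0")
    case True
    have "1 < real b" using assms by simp
    then have "1 < B" using B by linarith
    then show ?thesis
      using True c by (simp add: P_def digit_moment_0 [OF nB] c_def divide_strict_right_mono B)
  next
    case False
    then have m: "m \<ge> 1" by simp
    define S where "S L = (\<Sum>l<L. block_moment b m l / B ^ l)" for L
    \<comment> \<open>The integral of the excess \<open>1 - x\<close> over \<open>[1/b, 1]\<close>; being positive, it makes the lower bound strict.\<close>
    define Q where "Q = real m / real (m + 1) * (1 - 1 / real b) ^ (m + 1)"
    have S: "S \<longlonglongrightarrow> digit_moment b m B"
      using digit_moment_sums [OF nB, of m] by (simp add: sums_def S_def [abs_def])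
    have int_S: "((\<lambda>x. counting_sum b B L x * (real m * (1 - x) ^ (m - 1))) has_integral S L) {0..1}" for L
      unfolding S_def using assms m by (intro sum_block_moment_has_integral) auto
    have int_P: "((\<lambda>x. x powr \<sigma> * (real m * (1 - x) ^ (m - 1))) has_integral P) {0..1}"
      unfolding P_def using assms m by (intro has_integral_powr_power) auto
    have upper: "S L \<le> B * c * P" for L
    proof (rule has_integral_le [OF int_S has_integral_mult_right [OF int_P]])
      fix x :: real assume "x \<in> {0..1}"
      then have "counting_sum b B L x * (real m * (1 - x) ^ (m - 1))
          \<le> (B / (B - b) * x powr \<sigma>) * (real m * (1 - x) ^ (m - 1))"
        unfolding B_def using assms by (intro mult_right_mono counting_sum_le) auto
      then show "counting_sum b B L x * (real m * (1 - x) ^ (m - 1)) \<le>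
          B * c * (x powr \<sigma> * (real m * (1 - x) ^ (m - 1)))"
        by (simp add: c_def)
    qed
    have "((\<lambda>x. real m / real (m + 1) * (if 1 / real b \<le> x then real (m + 1) * (1 - x) ^ (m + 1 - 1) else 0))
        has_integral Q) {0..1}"
      unfolding Q_def using assms
      by (intro has_integral_mult_right has_integral_truncated_power) auto
    moreover have "real m / real (m + 1) * (if 1 / real b \<le> x then real (m + 1) * (1 - x) ^ (m + 1 - 1) else 0)
        = (if 1 / real b \<le> x then 1 - x else 0) * (real m * (1 - x) ^ (m - 1))" for x
      using m by (cases m) auto
    ultimately have int_Q: "((\<lambda>x. (if 1 / real b \<le> x then 1 - x else 0) * (real m * (1 - x) ^ (m - 1)))
        has_integral Q) {0..1}"
      by simp
    have int_1: "((\<lambda>x. real m * (1 - x) ^ (m - 1)) has_integral 1) {0..1}"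
      using has_integral_truncated_power [of 0 m] m
      by (auto elim!: has_integral_eq [rotated])
    have lower: "c * (P + Q) - (b / B) ^ L * (B * c) * 1 \<le> S L" for L
    proof (rule has_integral_le [OF has_integral_diff [OF has_integral_mult_right [OF has_integral_add [OF int_P int_Q]]
          has_integral_mult_right [OF int_1]] int_S])
      fix x :: real assume "x \<in> {0..1}"
      then have "(c * (x powr \<sigma> + (if 1 / real b \<le> x then 1 - x else 0)) - (b / B) ^ L * (B / (B - b)))
            * (real m * (1 - x) ^ (m - 1)) \<le> counting_sum b B L x * (real m * (1 - x) ^ (m - 1))"
        unfolding B_def c_def using assms by (intro mult_right_mono counting_sum_ge) auto
      then show "c * (x powr \<sigma> * (real m * (1 - x) ^ (m - 1))
             + (if 1 / real b \<le> x then 1 - x else 0) * (real m * (1 - x) ^ (m - 1)))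
           - (b / B) ^ L * (B * c) * (real m * (1 - x) ^ (m - 1))
          \<le> counting_sum b B L x * (real m * (1 - x) ^ (m - 1))"
        by (simp add: c_def algebra_simps)
    qed
    have "(\<lambda>L. c * (P + Q) - (b / B) ^ L * (B * c) * 1) \<longlonglongrightarrow> c * (P + Q) - 0 * (B * c) * 1"
      using B assms by (intro tendsto_intros LIMSEQ_power_zero) auto
    then have "c * (P + Q) \<le> digit_moment b m B"
      using LIMSEQ_le [OF _ S] lower by fastforce
    moreover have "Q > 0"
      unfolding Q_def using m assms by (intro mult_pos_pos zero_less_power) auto
    then have "c * P < c * (P + Q)" using c by simp
    moreover have "digit_moment b m B \<le> B * c * P"
      using S upper by (intro LIMSEQ_le_const2) auto
    ultimately show ?thesis by simp
  qed
  then show "1 / (B - b) * (fact m / pochhammer (\<sigma> + 1) m) < digit_moment b m B"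
    and "digit_moment b m B \<le> B / (B - b) * (fact m / pochhammer (\<sigma> + 1) m)"
    by (simp_all add: c_def P_def)
qed

section \<open>Bounds at complex exponents\<close>

text \<open>
  Each step multiplies the left-hand side by \<open>|s + n|/(Re s + n) \<ge> 1\<close>, so it increases with \<open>m\<close>; by the product
  formula of Gauss for the Gamma function the right-hand side is its limit.
\<close>

lemma pochhammer_ratio_le_Gamma_ratio:
  fixes s :: complex
  assumes "Re s > 0"
  shows "norm (pochhammer s m) / pochhammer (Re s) m \<le> Gamma (Re s) / norm (Gamma s)"
proof -
  define q where "q n = norm (pochhammer s n) / pochhammer (Re s) n" for n
  have "q n \<le> q (Suc n)" for n
  proof -
    have "Re s + real n \<le> norm (s + of_nat n)"
      using complex_Re_le_cmod [of "s + of_nat n"] by simp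
    then have "1 \<le> norm (s + of_nat n) / (Re s + real n)"
      using assms by simp
    then have "q n * 1 \<le> q n * (norm (s + of_nat n) / (Re s + real n))"
      using assms by (intro mult_left_mono) (auto simp: q_def pochhammer_nonneg)
    then show ?thesis
      by (simp add: q_def pochhammer_Suc norm_mult)
  qed
  then have "incseq q" by (rule incseq_SucI)
  have "Gamma s \<noteq> 0"
    using assms by (auto simp: Gamma_eq_zero_iff elim!: nonpos_Ints_cases)
  then have "(\<lambda>n. Gamma_series (Re s) n / norm (Gamma_series s n)) \<longlonglongrightarrow> Gamma (Re s) / norm (Gamma s)"
    by (intro tendsto_intros) auto
  moreover have "Gamma_series (Re s) n / norm (Gamma_series s n) = q (Suc n)" for n
    by (simp add: Gamma_series_def q_def norm_divide norm_mult norm_power del: pochhammer_Suc)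
  ultimately have "q \<longlonglongrightarrow> Gamma (Re s) / norm (Gamma s)"
    by (simp add: filterlim_sequentially_Suc)
  with \<open>incseq q\<close> show ?thesis
    unfolding q_def by (rule incseq_le)
qed

lemma u_star_real_bounds:
  fixes \<sigma> :: real
  assumes "b > 1" "\<sigma> > 1"
  shows "1 / (of_nat b powr \<sigma> - of_nat b) < u_star b m \<sigma>"
    and "u_star b m \<sigma> \<le> of_nat b powr \<sigma> / (of_nat b powr \<sigma> - of_nat b)"
proof -
  define p where "p = pochhammer (\<sigma> + 1) m / fact m"
  have p: "p > 0" using assms by (simp add: p_def pochhammer_pos)
  have inv: "fact m / pochhammer (\<sigma> + 1) m = 1 / p" by (simp add: p_def)
  have u: "u_star b m \<sigma> = p * digit_moment b m (of_nat b powr \<sigma>)"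
    using assms by (simp add: u_star_def p_def u_coeff_real_eq_digit_moment)
  show "1 / (of_nat b powr \<sigma> - of_nat b) < u_star b m \<sigma>"
    using mult_strict_left_mono [OF digit_moment_bounds(1) [OF assms, of m], of p] p unfolding inv u by simp
  show "u_star b m \<sigma> \<le> of_nat b powr \<sigma> / (of_nat b powr \<sigma> - of_nat b)"
    using mult_left_mono [OF digit_moment_bounds(2) [OF assms, of m], of p] p unfolding inv u by simp
qed

lemma norm_u_coeff_le:
  fixes s :: complex
  assumes "b > 1" "Re s > 1"
  shows "norm ((of_nat b powr s - of_nat b) * u_coeff b m s)
           \<le> (of_nat b powr Re s - of_nat b) * u_coeff b m (Re s)"
  using norm_digit_moment_le [of b "of_nat b powr s" m] assms norm_base_powr [of b s] less_base_powr [of b "Re s"]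
  by (simp add: u_coeff_complex_eq_digit_moment u_coeff_real_eq_digit_moment)

text \<open>
  Dominate by the real exponent with \<open>norm_u_coeff_le\<close> and insert the upper bound for real exponents.
\<close>

lemma norm_u_star_le:
  fixes s :: complex
  assumes "b > 1" "Re s > 1"
  shows "norm (u_star b m s) \<le> norm (pochhammer (s + 1) m) / pochhammer (Re s + 1) m
           * (of_nat b powr Re s / norm (of_nat b powr s - of_nat b))"
proof -
  define B where "B = real b powr Re s"
  define q where "q = norm (of_nat b powr s - of_nat b :: complex)"
  have B: "B > b" unfolding B_def by (rule less_base_powr [OF assms])
  have "of_nat b powr s \<noteq> (of_nat b :: complex)"
    using B norm_base_powr [of b s] assms by (auto simp: B_def)
  then have q: "q > 0" by (simp add: q_def)
  have p: "pochhammer (Re s + 1) m > 0" using assms by (intro pochhammer_pos) auto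
  have "q * norm (u_coeff b m s) \<le> (B - b) * u_coeff b m (Re s)"
    using norm_u_coeff_le [OF assms, of m] by (simp add: norm_mult q_def B_def)
  also have "(B - b) * u_coeff b m (Re s) = (B - b) * u_star b m (Re s) * (fact m / pochhammer (Re s + 1) m)"
    using p by (simp add: u_star_def)
  also have "\<dots> \<le> B * (fact m / pochhammer (Re s + 1) m)"
  proof (rule mult_right_mono)
    show "(B - b) * u_star b m (Re s) \<le> B"
      using u_star_real_bounds(2) [OF assms, of m] B by (simp add: B_def field_simps)
  qed (use p in auto)
  finally have "norm (u_coeff b m s) \<le> B * (fact m / pochhammer (Re s + 1) m) / q"
    using q by (simp only: pos_le_divide_eq mult.commute)
  then have "norm (pochhammer (s + 1) m) / fact m * norm (u_coeff b m s) \<le>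
      norm (pochhammer (s + 1) m) / fact m * (B * (fact m / pochhammer (Re s + 1) m) / q)"
    by (intro mult_left_mono) auto
  then show ?thesis
    by (simp add: u_star_def norm_mult norm_divide B_def q_def)
qed

lemma norm_pochhammer_ratio_bound:
  fixes s :: complex
  assumes "Re s > 1"
  shows "norm (pochhammer (s + 1) m) / pochhammer (Re s + 1) m * (of_nat b powr Re s / norm (of_nat b powr s - of_nat b))
      \<le> Gamma (Re s + 1) / norm (Gamma (s + 1)) * (of_nat b powr Re s / norm (of_nat b powr s - of_nat b))"
  using pochhammer_ratio_le_Gamma_ratio [of "s + 1" m] assms by (intro mult_right_mono) auto

section \<open>The geometrically convergent series for zeta\<close>

text \<open>
  Numbers grouped by their leading \<open>j + 1\<close> digits \<open>N\<close> and the number \<open>k\<close> of digits that follow.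
\<close>

lemma sum_digit_decomposition:
  fixes f :: "nat \<Rightarrow> 'a::comm_monoid_add"
  assumes "b > 1"
  shows "(\<Sum>n \<in> {0<..<b ^ (j + K)}. f n) = (\<Sum>n \<in> {0<..<b ^ j}. f n)
     + (\<Sum>k<K. \<Sum>N \<in> {b ^ j..<b ^ Suc j}. \<Sum>r<b ^ k. f (N * b ^ k + r))"
proof (induction K)
  case (Suc K)
  have "(\<Sum>N \<in> {b ^ j..<b ^ Suc j}. \<Sum>r<b ^ K. f (N * b ^ K + r)) = sum f {b ^ j * b ^ K..<b ^ Suc j * b ^ K}"
    using assms by (intro sum_base_block [symmetric]) auto
  then have "(\<Sum>N \<in> {b ^ j..<b ^ Suc j}. \<Sum>r<b ^ K. f (N * b ^ K + r)) = sum f {b ^ (j + K)..<b ^ (j + Suc K)}"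
    by (simp add: power_add mult_ac)
  moreover have "{0<..<b ^ (j + Suc K)} = {0<..<b ^ (j + K)} \<union> {b ^ (j + K)..<b ^ (j + Suc K)}"
    using assms by (intro ivl_disj_un_two [symmetric]) auto
  ultimately show ?case
    using Suc.IH by (simp add: sum.union_disjoint ivl_disj_int add.assoc)
qed auto

lemma zeta_partial_sums:
  fixes s :: "'a::{real_normed_field, ln}"
  assumes "b > 1" and "summable (\<lambda>n. 1 / of_nat (Suc n) powr s)"
  shows "(\<lambda>K. \<Sum>n \<in> {0<..<b ^ (j + K)}. 1 / of_nat n powr s) \<longlonglongrightarrow> zeta s"
proof -
  have mono: "strict_mono (\<lambda>K. b ^ (j + K) - 1)"
  proof (rule strict_mono_Suc_iff [THEN iffD2], intro allI)
    fix K
    have "b ^ (j + K) < b ^ (j + Suc K)" "1 \<le> b ^ (j + K)"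
      using assms by (auto intro!: power_strict_increasing one_le_power simp del: power_Suc)
    then show "b ^ (j + K) - 1 < b ^ (j + Suc K) - 1" by (rule diff_less_mono)
  qed
  have "(\<lambda>M. \<Sum>n<M. 1 / of_nat (Suc n) powr s) \<longlonglongrightarrow> zeta s"
    unfolding zeta_def using assms(2) by (rule summable_LIMSEQ)
  then have "((\<lambda>M. \<Sum>n<M. 1 / of_nat (Suc n) powr s) \<circ> (\<lambda>K. b ^ (j + K) - 1)) \<longlonglongrightarrow> zeta s"
    using mono by (rule LIMSEQ_subseq_LIMSEQ)
  moreover have "(\<Sum>n<M - 1. 1 / of_nat (Suc n) powr s) = (\<Sum>n \<in> {0<..<M}. 1 / of_nat n powr s)" for M
    by (rule sum.reindex_bij_witness [of _ "\<lambda>n. n - 1" Suc]) auto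
  ultimately show ?thesis by (simp add: comp_def)
qed

lemma summable_zeta_real:
  fixes \<sigma> :: real
  assumes "\<sigma> > 1"
  shows "summable (\<lambda>n. 1 / of_nat (Suc n) powr \<sigma>)"
proof -
  have "summable (\<lambda>n. of_nat n powr (- \<sigma>) :: real)"
    using assms by (subst summable_real_powr_iff) auto
  then have "summable (\<lambda>n. of_nat (Suc n) powr (- \<sigma>) :: real)"
    by (subst summable_Suc_iff)
  then show ?thesis by (simp add: powr_minus_divide)
qed

lemma summable_zeta_complex:
  fixes s :: complex
  assumes "Re s > 1"
  shows "summable (\<lambda>n. 1 / of_nat (Suc n) powr s)"
proof (rule summable_norm_cancel)
  show "summable (\<lambda>n. norm (1 / of_nat (Suc n) powr s))"
    using summable_zeta_real [OF assms] norm_base_powr [of "Suc n" s for n]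
    by (simp add: norm_divide del: of_nat_Suc)
qed

text \<open>
  Since \<open>s (s+1)\<^sub>m = (s)\<^sub>m (s + m)\<close>, the factor in front of the moment is the binomial coefficient of \<open>-s\<close>.
\<close>

lemma zeta_term_eq_gbinomial:
  fixes s :: "'a::{real_normed_field, ln}"
  assumes "s + of_nat m \<noteq> 0"
  shows "zeta_term b l s m = ((- s) gchoose m) * u_coeff b m s
           * (\<Sum>n \<in> {b ^ (l - 1)..<b ^ l}. 1 / of_nat n powr (of_nat m + s))"
proof -
  have "s * pochhammer (s + 1) m = pochhammer s m * (s + of_nat m)"
    by (metis pochhammer_Suc pochhammer_rec)
  then have "s * (pochhammer (s + 1) m / fact m) / (s + of_nat m) = pochhammer s m / fact m"
    using assms by (simp add: divide_simps)
  then have "s * u_star b m s / (s + of_nat m) = pochhammer s m / fact m * u_coeff b m s"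
    unfolding u_star_def by (metis mult.assoc mult.commute times_divide_eq_left)
  then show ?thesis
    by (simp add: zeta_term_def gbinomial_pochhammer)
qed

text \<open>
  The contribution of the digit strings of length below \<open>K\<close> to the moment. With only these strings the
  binomial series may be summed over finitely many points.
\<close>

definition partial_moment :: "nat \<Rightarrow> nat \<Rightarrow> 'a \<Rightarrow> nat \<Rightarrow> 'a::real_normed_field" where
  "partial_moment b m B K = (\<Sum>k<K. of_real (block_moment b m k) / B ^ k)"

lemma partial_moment_tendsto:
  fixes B :: "'a::{real_normed_field, banach}"
  assumes "real b < norm B"
  shows "partial_moment b m B \<longlonglongrightarrow> digit_moment b m B"
  using digit_moment_sums [OF assms, of m] by (simp add: sums_def partial_moment_def [abs_def])

lemma norm_partial_moment_le:
  fixes B :: "'a::real_normed_field"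
  assumes "real b < norm B"
  shows "norm (partial_moment b m B K) \<le> norm B / (norm B - real b)"
proof -
  have geo: "(\<lambda>l. real b ^ l / norm B ^ l) sums (norm B / (norm B - real b))"
    using geometric_quotient_sums [of "real b" "norm B"] assms by simp
  have "norm (partial_moment b m B K) \<le> (\<Sum>k<K. norm (of_real (block_moment b m k) / B ^ k))"
    unfolding partial_moment_def by (rule norm_sum)
  also have "\<dots> \<le> (\<Sum>k<K. real b ^ k / norm B ^ k)"
    using block_moment_le block_moment_nonneg
    by (intro sum_mono) (simp add: norm_divide norm_power divide_right_mono)
  also have "\<dots> \<le> (\<Sum>k. real b ^ k / norm B ^ k)"
    using geo by (intro sum_le_suminf) (auto simp: sums_iff)
  also have "\<dots> = norm B / (norm B - real b)"
    using geo by (simp add: sums_iff)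
  finally show ?thesis .
qed

lemma nat_powr_block_complex:
  fixes s :: complex
  assumes "b > 0" "N > 0"
  shows "1 / of_nat (N * b ^ k + r) powr s = 1 / of_nat N powr s
    * (1 / (of_nat b powr s) ^ k * (1 + of_real (real r / real (b ^ k)) / of_nat N) powr (- s))"
proof -
  have base: "of_nat (b ^ k) powr s = (of_nat b powr s) ^ k"
    by (induction k) (use assms in \<open>simp_all add: powr_times_real\<close>)
  define y where "y = 1 + real r / real (b ^ k) / real N"
  have "real (N * b ^ k + r) = real N * (real (b ^ k) * y)"
    using assms by (simp add: y_def field_simps)
  then have "of_real (real (N * b ^ k + r)) = complex_of_real (real N * (real (b ^ k) * y))"
    by (rule arg_cong)
  then have "of_nat (N * b ^ k + r) = of_nat N * (of_nat (b ^ k) * complex_of_real y)"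
    by simp
  moreover have "y \<ge> 0" by (simp add: y_def)
  ultimately have "of_nat (N * b ^ k + r) powr s =
      of_nat N powr s * (of_nat (b ^ k) powr s * complex_of_real y powr s)"
    by (simp add: powr_times_real del: of_nat_power of_nat_add of_nat_mult)
  then have "1 / of_nat (N * b ^ k + r) powr s =
      1 / of_nat N powr s * (1 / (of_nat b powr s) ^ k * complex_of_real y powr (- s))"
    by (simp add: base powr_minus divide_inverse del: of_nat_power of_nat_add of_nat_mult)
  then show ?thesis by (simp add: y_def)
qed

text \<open>
  Obtained from the complex case, so that both are available in the same shape.
\<close>

lemma nat_powr_block_real:
  fixes \<sigma> :: real
  assumes "b > 0" "N > 0"
  shows "1 / of_nat (N * b ^ k + r) powr \<sigma> = 1 / of_nat N powr \<sigma>
    * (1 / (of_nat b powr \<sigma>) ^ k * (1 + of_real (real r / real (b ^ k)) / of_nat N) powr (- \<sigma>))"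
proof -
  have "of_real (1 / of_nat (N * b ^ k + r) powr \<sigma>) = complex_of_real (1 / of_nat N powr \<sigma>
    * (1 / (of_nat b powr \<sigma>) ^ k * (1 + of_real (real r / real (b ^ k)) / of_nat N) powr (- \<sigma>)))"
  proof -
    have "1 + real r / real (b ^ k) / real N \<ge> 0" by simp
    then show ?thesis
      using nat_powr_block_complex [OF assms, of k r "of_real \<sigma>"]
        powr_of_real [of "real (N * b ^ k + r)" \<sigma>] powr_of_real [of "real N" \<sigma>]
        powr_of_real [of "real b" \<sigma>] powr_of_real [of "1 + real r / real (b ^ k) / real N" "- \<sigma>"]
      by simp
  qed
  then show ?thesis by (simp only: of_real_eq_iff)
qed

definition tail_weight :: "nat \<Rightarrow> nat \<Rightarrow> 'a \<Rightarrow> nat \<Rightarrow> 'a::{real_normed_field, ln}" where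
  "tail_weight b j s m = (\<Sum>N \<in> {b ^ j..<b ^ Suc j}. 1 / of_nat N powr (of_nat m + s))"

text \<open>
  The \<open>m\<close>-th term of the binomial series of \<open>(1 + x/N)\<^sup>-\<^sup>s\<close>, integrated over the strings shorter than \<open>K\<close> and
  summed over \<open>N\<close>. The assumption is the one law of powers that is involved.
\<close>

lemma truncated_binomial_block_sum:
  fixes s :: "'a::{real_normed_field, ln}"
  assumes "\<And>N. N \<in> {b ^ j..<b ^ Suc j} \<Longrightarrow>
      1 / of_nat N powr (of_nat m + s) = 1 / of_nat N powr s * (1 / of_nat N ^ m)"
  shows "(\<Sum>k<K. \<Sum>N \<in> {b ^ j..<b ^ Suc j}. \<Sum>r<b ^ k. 1 / of_nat N powr s *
           (1 / B ^ k * (c * (of_real (real r / real (b ^ k)) / of_nat N) ^ m)))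
         = c * partial_moment b m B K * tail_weight b j s m"
proof -
  have "(\<Sum>r<b ^ k. 1 / of_nat N powr s * (1 / B ^ k * (c * (of_real (real r / real (b ^ k)) / of_nat N) ^ m)))
      = c * (of_real (block_moment b m k) / B ^ k) * (1 / of_nat N powr (of_nat m + s))"
    if "N \<in> {b ^ j..<b ^ Suc j}" for N k
    unfolding block_moment_def assms [OF that]
    by (simp add: sum_distrib_left sum_distrib_right sum_divide_distrib power_divide power_mult_distrib mult_ac)
  then have "(\<Sum>k<K. \<Sum>N \<in> {b ^ j..<b ^ Suc j}. \<Sum>r<b ^ k. 1 / of_nat N powr s *
           (1 / B ^ k * (c * (of_real (real r / real (b ^ k)) / of_nat N) ^ m)))
     = (\<Sum>k<K. \<Sum>N \<in> {b ^ j..<b ^ Suc j}.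
          c * (of_real (block_moment b m k) / B ^ k) * (1 / of_nat N powr (of_nat m + s)))"
    by (intro sum.cong refl)
  also have "\<dots> = c * partial_moment b m B K * tail_weight b j s m"
    unfolding partial_moment_def tail_weight_def by (simp only: sum_product sum_distrib_left [of c])
  finally show ?thesis .
qed

lemma powr_shift_complex:
  "N > 0 \<Longrightarrow> 1 / of_nat N powr (of_nat m + s :: complex) = 1 / of_nat N powr s * (1 / of_nat N ^ m)"
  by (simp add: powr_add)

lemma powr_shift_real:
  "N > 0 \<Longrightarrow> 1 / of_nat N powr (of_nat m + s :: real) = 1 / of_nat N powr s * (1 / of_nat N ^ m)"
  by (simp add: powr_add powr_realpow)

text \<open>
  The finite form of the expansion: a block of the zeta series is a finite sum of binomial series, which
  converge because \<open>x/N \<le> 1/2\<close> for \<open>j \<ge> 1\<close>.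
\<close>

lemma zeta_partial_sum_expansion:
  fixes s :: complex
  assumes "b > 1" "j \<ge> 1"
  shows "(\<lambda>m. ((- s) gchoose m) * partial_moment b m (of_nat b powr s) K * tail_weight b j s m) sums
     ((\<Sum>n \<in> {0<..<b ^ (j + K)}. 1 / of_nat n powr s) - (\<Sum>n \<in> {0<..<b ^ j}. 1 / of_nat n powr s))"
proof -
  define B where "B = of_nat b powr s"
  have N_ge: "N \<ge> 2" if "N \<in> {b ^ j..<b ^ Suc j}" for N
  proof -
    have "2 \<le> b" using assms by simp
    also have "b \<le> b ^ j" using assms by (simp add: self_le_power)
    finally show ?thesis using that by simp
  qed
  have "(\<lambda>m. \<Sum>k<K. \<Sum>N \<in> {b ^ j..<b ^ Suc j}. \<Sum>r<b ^ k. 1 / of_nat N powr s *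
           (1 / B ^ k * (((- s) gchoose m) * (of_real (real r / real (b ^ k)) / of_nat N) ^ m)))
     sums (\<Sum>k<K. \<Sum>N \<in> {b ^ j..<b ^ Suc j}. \<Sum>r<b ^ k. 1 / of_nat N powr s *
           (1 / B ^ k * (1 + of_real (real r / real (b ^ k)) / of_nat N) powr (- s)))"
  proof (intro sums_sum sums_mult gen_binomial_complex)
    fix k N r assume N: "N \<in> {b ^ j..<b ^ Suc j}" and r: "r \<in> {..<b ^ k}"
    have "real r / real (b ^ k) < 1" using r by (simp add: divide_simps del: of_nat_power)
    also have "1 < real N" using N_ge [OF N] by simp
    finally have "\<bar>real r / real (b ^ k)\<bar> < real N"
      by (simp only: abs_of_nonneg of_nat_0_le_iff divide_nonneg_nonneg)
    then have "\<bar>real r / real (b ^ k)\<bar> / real N < 1"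
      using \<open>1 < real N\<close> by (simp only: divide_less_eq_1_pos)
    then show "norm (complex_of_real (real r / real (b ^ k)) / of_nat N) < 1"
      by (simp only: norm_divide norm_of_real norm_of_nat)
  qed
  also have "(\<lambda>m. \<Sum>k<K. \<Sum>N \<in> {b ^ j..<b ^ Suc j}. \<Sum>r<b ^ k. 1 / of_nat N powr s *
           (1 / B ^ k * (((- s) gchoose m) * (of_real (real r / real (b ^ k)) / of_nat N) ^ m)))
     = (\<lambda>m. ((- s) gchoose m) * partial_moment b m B K * tail_weight b j s m)"
    by (rule ext, rule truncated_binomial_block_sum, rule powr_shift_complex) (use N_ge in force)
  also have "(\<Sum>k<K. \<Sum>N \<in> {b ^ j..<b ^ Suc j}. \<Sum>r<b ^ k. 1 / of_nat N powr s *
           (1 / B ^ k * (1 + of_real (real r / real (b ^ k)) / of_nat N) powr (- s)))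
     = (\<Sum>k<K. \<Sum>N \<in> {b ^ j..<b ^ Suc j}. \<Sum>r<b ^ k. 1 / of_nat (N * b ^ k + r) powr s)"
    unfolding B_def
    by (intro sum.cong refl nat_powr_block_complex [symmetric]) (use N_ge assms in force)+
  also have "\<dots> = (\<Sum>n \<in> {0<..<b ^ (j + K)}. 1 / of_nat n powr s) - (\<Sum>n \<in> {0<..<b ^ j}. 1 / of_nat n powr s)"
    using sum_digit_decomposition [OF assms(1), of "\<lambda>n. 1 / of_nat n powr s" j K] by simp
  finally show ?thesis by (simp add: B_def)
qed

text \<open>
  Let \<open>K \<rightarrow> \<infinity>\<close> in \<open>zeta_partial_sum_expansion\<close>. Partial moments are bounded by \<open>|B|/(|B| - b)\<close>
  uniformly in \<open>m\<close> and \<open>K\<close>, and all \<open>N\<close> are at least \<open>2\<close>, so the absolutely convergent binomial series at \<open>1/2\<close>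
  is a majorant and Tannery's theorem applies.
\<close>

lemma zeta_expansion:
  fixes s :: complex
  assumes "b > 1" "Re s > 1" "l \<ge> 2"
  shows "summable (\<lambda>m. norm (zeta_term b l s m))"
    and "zeta s = zeta_head b l s + (\<Sum>m. zeta_term b l s m)"
proof -
  define B where "B = of_nat b powr s"
  have B: "real b < norm B"
    unfolding B_def using assms less_base_powr norm_base_powr by simp
  define j where "j = l - 1"
  have l: "l = Suc j" "j \<ge> 1" using assms by (auto simp: j_def)
  have N_ge: "N \<ge> 2" if "N \<in> {b ^ j..<b ^ Suc j}" for N
  proof -
    have "2 \<le> b" using assms by simp
    also have "b \<le> b ^ j" using assms l by (simp add: self_le_power)
    finally show ?thesis using that by simp
  qed
  define z where "z K m = ((- s) gchoose m) * partial_moment b m B K * tail_weight b j s m" for K m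
  define D where "D = norm B / (norm B - real b)"
  define M where "M m = D * norm (((- s) gchoose m) * (1 / 2) ^ m)
      * (\<Sum>N \<in> {b ^ j..<b ^ Suc j}. norm (1 / of_nat N powr s))" for m
  \<comment> \<open>Convergence at a point beyond \<open>1/2\<close> gives absolute convergence at \<open>1/2\<close>.\<close>
  have "(\<lambda>m. ((- s) gchoose m) * (3 / 4) ^ m) sums (1 + 3 / 4) powr (- s)"
    by (rule gen_binomial_complex) simp
  then have "summable (\<lambda>m. norm (((- s) gchoose m) * (1 / 2) ^ m))"
    by (intro powser_insidea [of _ "3 / 4"]) (auto simp: sums_iff)
  then have summable_M: "summable M"
    unfolding M_def by (intro summable_mult summable_mult2)
  have bound: "norm (z K m) \<le> M m" for K m
  proof -
    have "norm (tail_weight b j s m) \<le> (\<Sum>N \<in> {b ^ j..<b ^ Suc j}. (1 / 2) ^ m * norm (1 / of_nat N powr s))"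
      unfolding tail_weight_def
    proof (rule sum_norm_le)
      fix N assume N: "N \<in> {b ^ j..<b ^ Suc j}"
      have "(1 / real N) ^ m \<le> (1 / 2) ^ m"
        using N_ge [OF N] by (intro power_mono) (auto simp: field_simps)
      then have "norm (1 / of_nat N powr s) * (1 / real N) ^ m \<le> norm (1 / of_nat N powr s) * (1 / 2) ^ m"
        by (intro mult_left_mono) auto
      moreover have "1 / of_nat N powr (of_nat m + s) = 1 / of_nat N powr s * (1 / of_nat N ^ m)"
        using N_ge [OF N] by (intro powr_shift_complex) auto
      ultimately show "norm (1 / of_nat N powr (of_nat m + s)) \<le> (1 / 2) ^ m * norm (1 / of_nat N powr s)"
        by (simp only: norm_mult) (simp add: norm_divide norm_power power_divide mult.commute)
    qed
    then have "norm (z K m) \<le> norm ((- s) gchoose m) * D *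
        (\<Sum>N \<in> {b ^ j..<b ^ Suc j}. (1 / 2) ^ m * norm (1 / of_nat N powr s))"
      unfolding z_def norm_mult D_def
      using norm_partial_moment_le [OF B] B
      by (intro mult_mono) (auto intro!: sum_nonneg mult_nonneg_nonneg)
    also have "\<dots> = M m"
      by (simp add: M_def norm_mult norm_power sum_distrib_left mult_ac)
    finally show ?thesis .
  qed
  have limit: "(\<lambda>K. z K m) \<longlonglongrightarrow> zeta_term b l s m" for m
  proof -
    have "s + of_nat m \<noteq> 0"
    proof
      assume "s + of_nat m = 0"
      then have "Re (s + of_nat m) = 0" by simp
      then show False using assms by simp
    qed
    then have "zeta_term b l s m = ((- s) gchoose m) * digit_moment b m B * tail_weight b j s m"
      using assms by (simp add: zeta_term_eq_gbinomial u_coeff_complex_eq_digit_moment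
          B_def tail_weight_def l)
    then show ?thesis
      unfolding z_def by (auto intro!: tendsto_intros partial_moment_tendsto B)
  qed
  have tannery: "eventually (\<lambda>K. summable (\<lambda>m. norm (z K m))) sequentially \<and>
      summable (\<lambda>m. norm (zeta_term b l s m)) \<and>
      (\<lambda>K. suminf (z K)) \<longlonglongrightarrow> (\<Sum>m. zeta_term b l s m)"
    using tannerys_theorem [of "\<lambda>m K. z K m", OF limit _ summable_M] bound by (simp add: case_prod_unfold)
  then show "summable (\<lambda>m. norm (zeta_term b l s m))" by blast
  have "(\<lambda>K. (\<Sum>n \<in> {0<..<b ^ (j + K)}. 1 / of_nat n powr s) - zeta_head b l s) \<longlonglongrightarrow> zeta s - zeta_head b l s"
    using assms by (intro tendsto_diff tendsto_const zeta_partial_sums summable_zeta_complex)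
  moreover have "suminf (z K) = (\<Sum>n \<in> {0<..<b ^ (j + K)}. 1 / of_nat n powr s) - zeta_head b l s" for K
    using zeta_partial_sum_expansion [OF assms(1) l(2), of s K]
    by (simp add: sums_iff z_def [abs_def] B_def zeta_head_def j_def)
  ultimately have "(\<lambda>K. suminf (z K)) \<longlonglongrightarrow> zeta s - zeta_head b l s" by simp
  then have "zeta s - zeta_head b l s = (\<Sum>m. zeta_term b l s m)"
    using tannery by (blast intro: LIMSEQ_unique)
  then show "zeta s = zeta_head b l s + (\<Sum>m. zeta_term b l s m)"
    by (simp add: algebra_simps)
qed

text \<open>
  The numbers \<open>u\<^sub>m\<^sup>*\<close> are bounded, \<open>1/|s + m| \<le> 1/m\<close>, and each of the finitely many \<open>n\<close> satisfies
  \<open>n \<ge> b\<^sup>l\<^sup>-\<^sup>1\<close>.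
\<close>

lemma zeta_term_bigo:
  fixes s :: complex
  assumes "b > 1" "Re s > 1" "l \<ge> 1"
  shows "zeta_term b l s \<in> O(\<lambda>m. of_real ((real b powi (1 - int l)) ^ m / real m))"
proof -
  define C where "C = Gamma (Re s + 1) / norm (Gamma (s + 1)) * (of_nat b powr Re s / norm (of_nat b powr s - of_nat b))"
  define r where "r = 1 / real (b ^ (l - 1))"
  have r: "real b powi (1 - int l) = r"
  proof -
    have "1 - int l = - int (l - 1)" using assms by simp
    then show ?thesis
      by (simp only: r_def power_int_minus power_int_of_nat of_nat_power inverse_eq_divide)
  qed
  have C: "norm (u_star b m s) \<le> C" for m
    unfolding C_def
    by (rule order_trans [OF norm_u_star_le norm_pochhammer_ratio_bound]) (use assms in auto)
  then have C0: "C \<ge> 0" by (rule order_trans [OF norm_ge_zero])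
  have "norm (zeta_term b l s m) \<le> norm s * C * card {b ^ (l - 1)..<b ^ l} * norm (of_real (r ^ m / real m) :: complex)"
    if m: "m \<ge> 1" for m
  proof -
    have "real m \<le> norm (s + of_nat m)"
      using complex_Re_le_cmod [of "s + of_nat m"] assms by simp
    then have "norm (s * u_star b m s / (s + of_nat m)) \<le> norm s * C / real m"
      unfolding norm_divide norm_mult using m C C0 by (intro frac_le mult_left_mono) auto
    moreover have "norm (\<Sum>n \<in> {b ^ (l - 1)..<b ^ l}. 1 / of_nat n powr (of_nat m + s)) \<le>
        (\<Sum>n \<in> {b ^ (l - 1)..<b ^ l}. r ^ m)"
    proof (rule sum_norm_le)
      fix n assume "n \<in> {b ^ (l - 1)..<b ^ l}"
      then have n: "b ^ (l - 1) \<le> n" by simp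
      have b: "0 < b ^ (l - 1)" using assms by simp
      then have n1: "n \<ge> 1" using n by linarith
      have "real (b ^ (l - 1)) ^ m \<le> real n ^ m"
        using n by (intro power_mono) (simp_all only: of_nat_le_iff of_nat_0_le_iff)
      also have "real n ^ m = real n powr real m"
        using n1 by (simp add: powr_realpow)
      also have "\<dots> \<le> real n powr (real m + Re s)"
        using n1 assms by (intro powr_mono) auto
      finally have "1 / real n powr (real m + Re s) \<le> 1 / real (b ^ (l - 1)) ^ m"
        using b by (intro frac_le) auto
      then show "norm (1 / of_nat n powr (of_nat m + s)) \<le> r ^ m"
        using n1 norm_base_powr [of n "of_nat m + s"] by (simp add: norm_divide r_def power_divide)
    qed
    ultimately have "norm (zeta_term b l s m) \<le> norm s * C / real m * (\<Sum>n \<in> {b ^ (l - 1)..<b ^ l}. r ^ m)"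
      unfolding zeta_term_def norm_mult
      by (intro mult_mono) (auto simp: norm_power intro: order_trans [OF norm_ge_zero])
    then show ?thesis
      by (simp add: r_def norm_divide norm_power)
  qed
  then show ?thesis
    unfolding r by (intro bigoI eventually_sequentiallyI)
qed

section \<open>Alternating bounds at real exponents\<close>

text \<open>
  Let \<open>d\<^sub>M\<^sub>,\<^sub>a(y)\<close> be the error of the first \<open>M\<close> terms of the binomial series of \<open>(1 + y)\<^sup>-\<^sup>a\<close>. It vanishes at
  \<open>0\<close> for \<open>M \<ge> 1\<close>, and its derivative is \<open>-a d\<^sub>M\<^sub>-\<^sub>1\<^sub>,\<^sub>a\<^sub>+\<^sub>1\<close>; so the sign alternates with \<open>M\<close>. The series itself need
  not converge, as \<open>y\<close> may exceed \<open>1\<close>.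
\<close>

lemma binomial_partial_sum_sign:
  fixes a y :: real
  assumes "a > 0" "y \<ge> 0"
  shows "0 \<le> (- 1) ^ M * ((1 + y) powr (- a) - (\<Sum>m<M. ((- a) gchoose m) * y ^ m))"
  using assms
proof (induction M arbitrary: a y)
  case 0
  then show ?case by simp
next
  case (Suc M)
  define d where "d a y = (1 + y) powr (- a) - (\<Sum>m<M. ((- a) gchoose m) * y ^ m)" for a y :: real
  define D where "D y = (1 + y) powr (- a) - (\<Sum>m<Suc M. ((- a) gchoose m) * y ^ m)" for y :: real
  have deriv: "(D has_real_derivative - a * d (a + 1) t) (at t)" if "t \<ge> 0" for t
  proof -
    have absorb: "real (Suc m) * ((- a) gchoose Suc m) = - a * ((- (a + 1)) gchoose m)" for m
    proof -
      have "- (a + 1) = - a - 1" by simp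
      then show ?thesis using gbinomial_absorption [of m "- a"] by (simp only:)
    qed
    have "D = (\<lambda>y. (1 + y) powr (- a) - (1 + (\<Sum>m<M. ((- a) gchoose Suc m) * y ^ Suc m)))"
      by (simp add: fun_eq_iff D_def sum.lessThan_Suc_shift del: sum.lessThan_Suc)
    moreover have "((\<lambda>y. (1 + y) powr (- a) - (1 + (\<Sum>m<M. ((- a) gchoose Suc m) * y ^ Suc m)))
        has_real_derivative (- a * (1 + t) powr (- a - 1)
          - (\<Sum>m<M. ((- a) gchoose Suc m) * (real (Suc m) * t ^ m)))) (at t)"
      using that by (auto intro!: derivative_eq_intros simp: powr_diff mult_ac simp del: power_Suc)
    moreover have "(\<Sum>m<M. ((- a) gchoose Suc m) * (real (Suc m) * t ^ m))
        = - a * (\<Sum>m<M. ((- (a + 1)) gchoose m) * t ^ m)"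
      unfolding sum_distrib_left
    proof (intro sum.cong refl)
      fix m
      have "((- a) gchoose Suc m) * (real (Suc m) * t ^ m) = real (Suc m) * ((- a) gchoose Suc m) * t ^ m"
        by (simp only: mult_ac)
      then show "((- a) gchoose Suc m) * (real (Suc m) * t ^ m) = - a * (((- (a + 1)) gchoose m) * t ^ m)"
        by (simp only: absorb mult.assoc)
    qed
    ultimately have "(D has_real_derivative (- a * (1 + t) powr (- a - 1)
        - (- a * (\<Sum>m<M. ((- (a + 1)) gchoose m) * t ^ m)))) (at t)"
      by (simp only:)
    moreover have "- a - 1 = - (a + 1)" by simp
    ultimately show ?thesis
      by (simp only: d_def right_diff_distrib)
  qed
  have "(- 1) ^ Suc M * D 0 \<le> (- 1) ^ Suc M * D y"
  proof (rule DERIV_nonneg_imp_nondecreasing [OF \<open>y \<ge> 0\<close>])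
    fix t assume t: "0 \<le> t" "t \<le> y"
    have "((\<lambda>y. (- 1) ^ Suc M * D y) has_real_derivative (- 1) ^ Suc M * (- a * d (a + 1) t)) (at t)"
      using t by (intro DERIV_cmult deriv)
    moreover have "0 \<le> a * ((- 1) ^ M * d (a + 1) t)"
      using Suc.IH [of "a + 1" t] Suc.prems t by (simp add: d_def)
    ultimately show "\<exists>z. ((\<lambda>y. (- 1) ^ Suc M * D y) has_real_derivative z) (at t) \<and> 0 \<le> z"
      by (intro exI conjI) (auto simp: mult_ac)
  qed
  moreover have "D 0 = 0"
    by (simp add: D_def sum.lessThan_Suc_shift del: sum.lessThan_Suc)
  ultimately show ?case by (simp add: D_def)
qed

text \<open>
  For fixed \<open>K\<close>, the difference is an integral of errors of \<open>binomial_partial_sum_sign\<close> with positive weights.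
  The sign persists in the limit \<open>K \<rightarrow> \<infinity>\<close>.
\<close>

lemma zeta_partial_expansion_sign:
  fixes \<sigma> :: real
  assumes "b > 1" "\<sigma> > 1" "l \<ge> 1"
  shows "0 \<le> (- 1) ^ M * (zeta \<sigma> - (zeta_head b l \<sigma> + (\<Sum>m<M. zeta_term b l \<sigma> m)))"
proof -
  define B where "B = of_nat b powr \<sigma>"
  have B: "real b < norm B" "B > 0"
    unfolding B_def using assms less_base_powr by auto
  define j where "j = l - 1"
  have l: "l = Suc j" using assms by (auto simp: j_def)
  have N_gt: "N > 0" if "N \<in> {b ^ j..<b ^ Suc j}" for N
    using that assms by (metis atLeastLessThan_iff gr0I less_le_trans not_one_less_zero zero_less_power)
  define z where "z K m = ((- \<sigma>) gchoose m) * partial_moment b m B K * tail_weight b j \<sigma> m" for K m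
  define P where "P K = (\<Sum>n \<in> {0<..<b ^ (j + K)}. 1 / of_nat n powr \<sigma>)" for K
  have limit: "(\<lambda>K. z K m) \<longlonglongrightarrow> zeta_term b l \<sigma> m" for m
  proof -
    have "\<sigma> + of_nat m \<noteq> 0" using assms by linarith
    then have "zeta_term b l \<sigma> m = ((- \<sigma>) gchoose m) * digit_moment b m B * tail_weight b j \<sigma> m"
      using assms by (simp add: zeta_term_eq_gbinomial u_coeff_real_eq_digit_moment
          B_def tail_weight_def l)
    then show ?thesis
      unfolding z_def by (auto intro!: tendsto_intros partial_moment_tendsto B)
  qed
  have lim_P: "P \<longlonglongrightarrow> zeta \<sigma>"
    unfolding P_def using assms by (intro zeta_partial_sums summable_zeta_real)
  have sign: "0 \<le> (- 1) ^ M * (P K - (zeta_head b l \<sigma> + (\<Sum>m<M. z K m)))" for K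
  proof -
    define y :: "nat \<Rightarrow> nat \<Rightarrow> nat \<Rightarrow> real" where
      "y N k r = of_real (real r / real (b ^ k)) / of_nat N" for N k r
    have block: "1 / of_nat (N * b ^ k + r) powr \<sigma> = 1 / of_nat N powr \<sigma> *
           (1 / B ^ k * (1 + y N k r) powr (- \<sigma>))" if "N \<in> {b ^ j..<b ^ Suc j}" for N k r
      unfolding B_def y_def using N_gt [OF that] assms by (intro nat_powr_block_real) linarith+
    have "P K - zeta_head b l \<sigma> =
        (\<Sum>k<K. \<Sum>N \<in> {b ^ j..<b ^ Suc j}. \<Sum>r<b ^ k. 1 / of_nat (N * b ^ k + r) powr \<sigma>)"
      unfolding P_def zeta_head_def using sum_digit_decomposition [OF assms(1), of "\<lambda>n. 1 / of_nat n powr \<sigma>" j K]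
      by (simp add: j_def)
    also have "\<dots> = (\<Sum>k<K. \<Sum>N \<in> {b ^ j..<b ^ Suc j}. \<Sum>r<b ^ k. 1 / of_nat N powr \<sigma> *
           (1 / B ^ k * (1 + y N k r) powr (- \<sigma>)))"
      by (intro sum.cong refl block)
    finally have P: "P K - zeta_head b l \<sigma> = \<dots>" .
    have "z K m = (\<Sum>k<K. \<Sum>N \<in> {b ^ j..<b ^ Suc j}. \<Sum>r<b ^ k. 1 / of_nat N powr \<sigma> *
           (1 / B ^ k * (((- \<sigma>) gchoose m) * y N k r ^ m)))" for m
      unfolding z_def y_def
      by (rule truncated_binomial_block_sum [symmetric], rule powr_shift_real, rule N_gt)
    then have "(\<Sum>m<M. z K m) = (\<Sum>m<M. \<Sum>k<K. \<Sum>N \<in> {b ^ j..<b ^ Suc j}. \<Sum>r<b ^ k. 1 / of_nat N powr \<sigma> *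
           (1 / B ^ k * (((- \<sigma>) gchoose m) * y N k r ^ m)))"
      by simp
    also have "\<dots> = (\<Sum>k<K. \<Sum>N \<in> {b ^ j..<b ^ Suc j}. \<Sum>r<b ^ k. \<Sum>m<M. 1 / of_nat N powr \<sigma> *
           (1 / B ^ k * (((- \<sigma>) gchoose m) * y N k r ^ m)))"
      by (simp only: sum.swap [of _ _ "{..<M}"])
    finally have Z: "(\<Sum>m<M. z K m) = \<dots>" .
    have pull_out: "(- 1) ^ M * (w * (v * A) - (\<Sum>m<M. w * (v * c m))) =
        w * (v * ((- 1) ^ M * (A - (\<Sum>m<M. c m))))" for w v A :: real and c :: "nat \<Rightarrow> real"
      by (simp add: right_diff_distrib mult_ac flip: sum_distrib_left)
    have "(- 1) ^ M * (P K - zeta_head b l \<sigma> - (\<Sum>m<M. z K m)) =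
      (\<Sum>k<K. \<Sum>N \<in> {b ^ j..<b ^ Suc j}. \<Sum>r<b ^ k. 1 / of_nat N powr \<sigma> * (1 / B ^ k *
         ((- 1) ^ M * ((1 + y N k r) powr (- \<sigma>) - (\<Sum>m<M. ((- \<sigma>) gchoose m) * y N k r ^ m)))))"
      unfolding P Z
      by (simp only: sum_subtractf [symmetric] sum_distrib_left [of "(- 1) ^ M"] pull_out)
    also have "\<dots> \<ge> 0"
      using B assms
      by (intro sum_nonneg mult_nonneg_nonneg binomial_partial_sum_sign) (auto simp: y_def)
    finally show ?thesis by (simp add: algebra_simps)
  qed
  have lim: "(\<lambda>K. (- 1) ^ M * (P K - (zeta_head b l \<sigma> + (\<Sum>m<M. z K m)))) \<longlonglongrightarrow>
      (- 1) ^ M * (zeta \<sigma> - (zeta_head b l \<sigma> + (\<Sum>m<M. zeta_term b l \<sigma> m)))"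
    by (intro tendsto_intros lim_P limit)
  show ?thesis
    by (rule LIMSEQ_le_const [OF lim]) (use sign in blast)
qed

section \<open>Moment coefficients and the zeta series\<close>

theorem theorem4p1:
  fixes b :: nat and s :: complex and \<sigma> :: real
  assumes "b > 1" and "\<sigma> = Re s" and "\<sigma> > 1"
  shows
    "(\<forall>m. cmod ((of_nat b powr s - of_nat b) * u_coeff b m s)
          \<le> (of_nat b powr \<sigma> - of_nat b) * u_coeff b m \<sigma>)
     \<and>
     (\<forall>m\<ge>1. u_star b m s =
        1 / (of_nat b powr (of_nat m + s) - of_nat b)
        * (\<Sum>j = 1..m. (\<Prod>i<j. s + of_nat m - of_nat i) / fact j
             * u_star b (m - j) s * (\<Sum>a<b. of_nat a ^ j)))
     \<and>
     (\<forall>m. 1 / (of_nat b powr \<sigma> - of_nat b) < u_star b m \<sigma>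
          \<and> u_star b m \<sigma> \<le> of_nat b powr \<sigma> / (of_nat b powr \<sigma> - of_nat b))
     \<and>
     (\<forall>m. cmod (u_star b m s)
            \<le> cmod (pochhammer (s + 1) m) / pochhammer (\<sigma> + 1) m
               * (of_nat b powr \<sigma> / cmod (of_nat b powr s - of_nat b))
          \<and> cmod (pochhammer (s + 1) m) / pochhammer (\<sigma> + 1) m
               * (of_nat b powr \<sigma> / cmod (of_nat b powr s - of_nat b))
            \<le> Gamma (\<sigma> + 1) / cmod (Gamma (s + 1))
               * (of_nat b powr \<sigma> / cmod (of_nat b powr s - of_nat b)))
     \<and>
     (\<forall>l\<ge>2. summable (\<lambda>m. cmod (zeta_term b l s m))
          \<and> zeta s = zeta_head b l s + (\<Sum>m. zeta_term b l s m))
     \<and>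
     (\<forall>l\<ge>2. \<forall>M.
          (even M \<longrightarrow> zeta_head b l \<sigma> + (\<Sum>m<M. zeta_term b l \<sigma> m) \<le> zeta \<sigma>)
          \<and> (odd M \<longrightarrow> zeta \<sigma> \<le> zeta_head b l \<sigma> + (\<Sum>m<M. zeta_term b l \<sigma> m)))
     \<and>
     (\<forall>l\<ge>2. zeta_term b l s
          \<in> O(\<lambda>m. of_real ((real b powi (1 - int l)) ^ m / real m)))"
proof -
  have s: "Re s > 1" using assms by simp
  have alternating: "(even M \<longrightarrow> zeta_head b l \<sigma> + (\<Sum>m<M. zeta_term b l \<sigma> m) \<le> zeta \<sigma>)
      \<and> (odd M \<longrightarrow> zeta \<sigma> \<le> zeta_head b l \<sigma> + (\<Sum>m<M. zeta_term b l \<sigma> m))"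
    if "l \<ge> 2" for l M
    using zeta_partial_expansion_sign [of b \<sigma> l M] assms that by auto
  show ?thesis
    using alternating zeta_expansion [OF assms(1) s] zeta_term_bigo [OF assms(1) s]
      norm_u_coeff_le [OF assms(1) s] u_star_recurrence [OF assms(1) s]
      u_star_real_bounds [OF assms(1,3)] norm_u_star_le [OF assms(1) s]
      norm_pochhammer_ratio_bound [OF s]
    unfolding assms(2) [symmetric]
    by (intro conjI allI impI) simp_all
qed

end
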